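(* Let $V$ be a group-like set. Then the category $\mathcal{F}_V$ is countable, directed, and has amalgamation. In particular, there exists a maximal and ultrahomogeneous (full) measure on $2^{\mathbb{N}}$ with clopen values set equal to $V$.
   Context: All measures are Borel probability measures; $2^{\mathbb{N}}$ is the Cantor space. A set $V$ is group-like if it is countably infinite, $\{0,1\}\subseteq V\subseteq[0,1]$, and $V+\mathbb{Z}$ is an additive subgroup of $\mathbb{R}$. A clopen partition is a finite partition of $2^{\mathbb{N}}$ into nonempty clopen sets. The category $\mathcal{F}_V$: objects are pairs $(P,\mu)$ where $P$ is a clopen partition of $2^{\mathbb{N}}$ and $\mu$ is a probability distribution on the finite set $P$ with $\mu(x)\in V$ and $\mu(x)>0$ for every $x\in P$. A morphism from $(Q,\nu)$ to $(P,\mu)$ is a surjection $p\colon Q\to P$ such that $\mu(x)=\sum_{y\in p^{-1}(\{x\})}\nu(y)$ for every $x\in P$. A category is directed if for any two objects $A_0,A_1$ there are an object $B$ and morphisms $B\to A_0$, $B\to A_1$. It has amalgamation if for any object $A$ and morphisms $r_i\colon B_i\to A$ ($i=0,1$) there are an object $C$ and morphisms $s_i\colon C\to B_i$ with $r_0\circ s_0=r_1\circ s_1$. A measure is full if it is positive on every nonempty open set; $V_\mu=\{\mu(U):U\text{ clopen}\}$ is its clopen values set. A full measure $\mu$ on $2^{\mathbb{N}}$ is ultrahomogeneous if for any clopen partitions $P,R$ and any bijection $f\colon P\to R$ with $\mu(x)=\mu(f(x))$ for all $x\in P$, there is a $\mu$-preserving homeomorphism $\varphi$ of $2^{\mathbb{N}}$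 with $\varphi[x]=f(x)$ for every $x\in P$. A measure $\mu$ on $2^{\mathbb{N}}$ is maximal if (i) for every tuple $v_1,\dots,v_n$ of non-zero elements of $V_\mu$ with $\sum_{i}v_i=1$ there is a clopen partition $\{x_1,\dots,x_n\}$ of $2^{\mathbb{N}}$ with $\mu(x_i)=v_i$ for all $i$, and (ii) $|v-w|\in V_\mu$ for all $v,w\in V_\mu$. *)

theory Defs
  imports "HOL-Probability.Probability" "HOL-Library.Disjoint_Sets" "HOL-Library.Set_Algebras"
begin

section \<open>Categories\<close>

text \<open>The composition \<open>Comp C A B D g f\<close>, for \<open>f\<close> from \<open>A\<close> to \<open>B\<close> and \<open>g\<close> from \<open>B\<close> to \<open>D\<close>, is given the
  objects involved, because hom-sets of different pairs of objects need not be disjoint.\<close>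

record ('o, 'm) cat =
  Ob :: "'o set"
  Hom :: "'o \<Rightarrow> 'o \<Rightarrow> 'm set"
  Ident :: "'o \<Rightarrow> 'm"
  Comp :: "'o \<Rightarrow> 'o \<Rightarrow> 'o \<Rightarrow> 'm \<Rightarrow> 'm \<Rightarrow> 'm"

locale category =
  fixes C :: "('o, 'm) cat"
  assumes ident_in_hom: "A \<in> Ob C \<Longrightarrow> Ident C A \<in> Hom C A A"
    and comp_in_hom: "\<lbrakk>A \<in> Ob C; B \<in> Ob C; D \<in> Ob C; f \<in> Hom C A B; g \<in> Hom C B D\<rbrakk>
      \<Longrightarrow> Comp C A B D g f \<in> Hom C A D"
    and comp_ident_right: "\<lbrakk>A \<in> Ob C; B \<in> Ob C; f \<in> Hom C A B\<rbrakk>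
      \<Longrightarrow> Comp C A A B f (Ident C A) = f"
    and comp_ident_left: "\<lbrakk>A \<in> Ob C; B \<in> Ob C; f \<in> Hom C A B\<rbrakk>
      \<Longrightarrow> Comp C A B B (Ident C B) f = f"
    and comp_assoc: "\<lbrakk>A \<in> Ob C; B \<in> Ob C; D \<in> Ob C; E \<in> Ob C;
        f \<in> Hom C A B; g \<in> Hom C B D; h \<in> Hom C D E\<rbrakk>
      \<Longrightarrow> Comp C A D E h (Comp C A B D g f) = Comp C A B E (Comp C B D E h g) f"

definition countable_cat :: "('o, 'm) cat \<Rightarrow> bool" where
  "countable_cat C \<longleftrightarrow> countable (Ob C) \<and>
     countable {(A, B, f). A \<in> Ob C \<and> B \<in> Ob C \<and> f \<in> Hom C A B}"

definition directed_cat :: "('o, 'm) cat \<Rightarrow> bool" where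
  "directed_cat C \<longleftrightarrow>
     (\<forall>A0\<in>Ob C. \<forall>A1\<in>Ob C. \<exists>B\<in>Ob C. Hom C B A0 \<noteq> {} \<and> Hom C B A1 \<noteq> {})"

definition has_amalgamation :: "('o, 'm) cat \<Rightarrow> bool" where
  "has_amalgamation C \<longleftrightarrow>
     (\<forall>A\<in>Ob C. \<forall>B0\<in>Ob C. \<forall>B1\<in>Ob C. \<forall>r0\<in>Hom C B0 A. \<forall>r1\<in>Hom C B1 A.
        \<exists>D\<in>Ob C. \<exists>s0\<in>Hom C D B0. \<exists>s1\<in>Hom C D B1.
          Comp C D B0 A r0 s0 = Comp C D B1 A r1 s1)"

section \<open>The Cantor space and the category of a group-like set\<close>

text \<open>The topology on this type is the product of the discrete topologies on \<^typ>\<open>bool\<close>.\<close>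

type_synonym cantor = "nat \<Rightarrow> bool"

definition clopen :: "cantor set \<Rightarrow> bool" where
  "clopen U \<longleftrightarrow> open U \<and> closed U"

definition clopen_partition :: "cantor set set \<Rightarrow> bool" where
  "clopen_partition P \<longleftrightarrow> finite P \<and> partition_on UNIV P \<and> (\<forall>x\<in>P. clopen x)"

definition additive_subgroup_real :: "real set \<Rightarrow> bool" where
  "additive_subgroup_real G \<longleftrightarrow> 0 \<in> G \<and> (\<forall>x\<in>G. \<forall>y\<in>G. x + y \<in> G) \<and> (\<forall>x\<in>G. - x \<in> G)"

definition group_like :: "real set \<Rightarrow> bool" where
  "group_like V \<longleftrightarrow> countable V \<and> infinite V \<and> {0, 1} \<subseteq> V \<and> V \<subseteq> {0..1} \<and>
     additive_subgroup_real (V + \<int>)"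

text \<open>Functions defined on a partition are taken in \<open>\<rightarrow>\<^sub>E\<close>, that is, \<^const>\<open>undefined\<close> off the
  partition, so that objects and morphisms are determined by their values there.\<close>

definition F_ob :: "real set \<Rightarrow> (cantor set set \<times> (cantor set \<Rightarrow> real)) set" where
  "F_ob V = {(P, \<mu>). clopen_partition P \<and> \<mu> \<in> P \<rightarrow>\<^sub>E V \<and> (\<forall>x\<in>P. \<mu> x > 0) \<and> (\<Sum>x\<in>P. \<mu> x) = 1}"

definition F_hom :: "cantor set set \<times> (cantor set \<Rightarrow> real) \<Rightarrow> cantor set set \<times> (cantor set \<Rightarrow> real)
    \<Rightarrow> (cantor set \<Rightarrow> cantor set) set" where
  "F_hom = (\<lambda>(Q, \<nu>) (P, \<mu>). {p \<in> Q \<rightarrow>\<^sub>E P. p ` Q = P \<and> (\<forall>x\<in>P. \<mu> x = (\<Sum>y | y \<in> Q \<and> p y = x. \<nu> y))})"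

definition F_cat ::
  "real set \<Rightarrow> (cantor set set \<times> (cantor set \<Rightarrow> real), cantor set \<Rightarrow> cantor set) cat" where
  "F_cat V = \<lparr>Ob = F_ob V, Hom = F_hom, Ident = (\<lambda>A. restrict (\<lambda>x. x) (fst A)),
     Comp = (\<lambda>A B D g f. compose (fst A) g f)\<rparr>"

lemma F_hom_comp:
  assumes "finite Q" "finite P" "f \<in> F_hom (Q, \<nu>) (P, \<mu>)" "g \<in> F_hom (P, \<mu>) (R, \<rho>)"
  shows "compose Q g f \<in> F_hom (Q, \<nu>) (R, \<rho>)"
proof -
  have f: "f \<in> Q \<rightarrow>\<^sub>E P" "f ` Q = P" "\<And>x. x \<in> P \<Longrightarrow> \<mu> x = (\<Sum>y | y \<in> Q \<and> f y = x. \<nu> y)"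
    and g: "g \<in> P \<rightarrow>\<^sub>E R" "g ` P = R" "\<And>x. x \<in> R \<Longrightarrow> \<rho> x = (\<Sum>y | y \<in> P \<and> g y = x. \<mu> y)"
    using assms by (auto simp: F_hom_def)
  have "compose Q g f \<in> Q \<rightarrow>\<^sub>E R"
    using f(1) g(1) by (auto simp: compose_def)
  moreover have "compose Q g f ` Q = R"
    using f(2) g(2) by (force simp: compose_def)
  moreover have "\<rho> z = (\<Sum>y | y \<in> Q \<and> compose Q g f y = z. \<nu> y)" if z: "z \<in> R" for z
  proof -
    have "\<rho> z = (\<Sum>x\<in>{x \<in> P. g x = z}. \<Sum>y\<in>{y \<in> {y \<in> Q. g (f y) = z}. f y = x}. \<nu> y)"
      unfolding g(3)[OF z] using f(3) by (intro sum.cong) (auto intro!: sum.cong)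
    also have "\<dots> = (\<Sum>y\<in>{y \<in> Q. g (f y) = z}. \<nu> y)"
      by (rule sum.group) (use assms f(1) in auto)
    also have "\<dots> = (\<Sum>y | y \<in> Q \<and> compose Q g f y = z. \<nu> y)"
      by (intro sum.cong) (auto simp: compose_def)
    finally show ?thesis .
  qed
  ultimately show ?thesis by (auto simp: F_hom_def)
qed

lemma category_F_cat: "category (F_cat V)"
proof
  fix A assume "A \<in> Ob (F_cat V)"
  show "Ident (F_cat V) A \<in> Hom (F_cat V) A A"
  proof -
    obtain P \<mu> where A: "A = (P, \<mu>)" by force
    have "{y. y \<in> P \<and> restrict (\<lambda>x. x) P y = x} = {x}" if "x \<in> P" for x using that by auto
    then show ?thesis by (auto simp: A F_cat_def F_hom_def)
  qed
next
  fix A B D f g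
  assume "A \<in> Ob (F_cat V)" "B \<in> Ob (F_cat V)" "D \<in> Ob (F_cat V)"
    "f \<in> Hom (F_cat V) A B" "g \<in> Hom (F_cat V) B D"
  then show "Comp (F_cat V) A B D g f \<in> Hom (F_cat V) A D"
    by (cases A; cases B; cases D)
      (auto simp: F_cat_def F_ob_def clopen_partition_def intro: F_hom_comp)
next
  fix A B f assume "f \<in> Hom (F_cat V) A B"
  then have f: "f \<in> fst A \<rightarrow>\<^sub>E fst B" by (cases A; cases B) (auto simp: F_cat_def F_hom_def)
  show "Comp (F_cat V) A A B f (Ident (F_cat V) A) = f"
    using f by (auto simp: F_cat_def compose_def fun_eq_iff PiE_def extensional_def)
  show "Comp (F_cat V) A B B (Ident (F_cat V) B) f = f"
    using f by (auto simp: F_cat_def compose_def fun_eq_iff PiE_def extensional_def)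
next
  fix A B D E f g h
  assume "f \<in> Hom (F_cat V) A B"
  then have f: "f \<in> fst A \<rightarrow>\<^sub>E fst B" by (cases A; cases B) (auto simp: F_cat_def F_hom_def)
  then show "Comp (F_cat V) A D E h (Comp (F_cat V) A B D g f)
      = Comp (F_cat V) A B E (Comp (F_cat V) B D E h g) f"
    by (auto simp: F_cat_def compose_def fun_eq_iff)
qed

section \<open>Measures on the Cantor space\<close>

definition borel_prob :: "cantor measure \<Rightarrow> bool" where
  "borel_prob \<mu> \<longleftrightarrow> sets \<mu> = sets borel \<and> prob_space \<mu>"

definition full_measure :: "cantor measure \<Rightarrow> bool" where
  "full_measure \<mu> \<longleftrightarrow> (\<forall>U. open U \<and> U \<noteq> {} \<longrightarrow> measure \<mu> U > 0)"

definition clopen_values :: "cantor measure \<Rightarrow> real set" where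
  "clopen_values \<mu> = {measure \<mu> U | U. clopen U}"

definition ultrahomogeneous :: "cantor measure \<Rightarrow> bool" where
  "ultrahomogeneous \<mu> \<longleftrightarrow>
     (\<forall>P R f. clopen_partition P \<and> clopen_partition R \<and> bij_betw f P R \<and>
        (\<forall>x\<in>P. measure \<mu> x = measure \<mu> (f x)) \<longrightarrow>
        (\<exists>\<phi> \<psi>. homeomorphism UNIV UNIV \<phi> \<psi> \<and> distr \<mu> \<mu> \<phi> = \<mu> \<and> (\<forall>x\<in>P. \<phi> ` x = f x)))"

text \<open>In the first clause the cells \<open>x i\<close> are pairwise distinct: an \<open>n\<close>-tuple of values is
  realised by a partition into \<open>n\<close> cells, even if some values coincide.\<close>

definition maximal_measure :: "cantor measure \<Rightarrow> bool" where
  "maximal_measure \<mu> \<longleftrightarrow>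
     (\<forall>(n::nat) v. (\<forall>i<n. v i \<in> clopen_values \<mu> \<and> v i \<noteq> 0) \<and> (\<Sum>i<n. v i) = 1 \<longrightarrow>
        (\<exists>x. inj_on x {..<n} \<and> clopen_partition (x ` {..<n}) \<and> (\<forall>i<n. measure \<mu> (x i) = v i))) \<and>
     (\<forall>v\<in>clopen_values \<mu>. \<forall>w\<in>clopen_values \<mu>. \<bar>v - w\<bar> \<in> clopen_values \<mu>)"

end

theory Submission
  imports Defs
begin

text \<open>Since \<open>V\<close> is infinite, \<open>V + \<int>\<close> is a dense subgroup of the reals and \<open>V\<close> is its intersection with
  \<open>[0, 1]\<close>. Doubling every interior point of \<open>V\<close> turns \<open>[0, 1)\<close> into a Cantor space whose clopen sets are
  the finite unions of intervals \<open>[a, b)\<close> with \<open>a, b \<in> V\<close>. The required measure is Lebesgue measure on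
  this space. Its clopen values are the elements of \<open>V\<close>, and any partition into prescribed values is cut
  out by intervals. Two clopen sets of equal measure are related by a finite interval exchange whose
  translation lengths lie in \<open>V + \<int>\<close>; such an exchange extends to a homeomorphism of the Cantor
  space, which yields ultrahomogeneity.

  Amalgamation is solved fibrewise by a transport matrix with prescribed marginals and entries in
  \<open>V + \<int>\<close>, its nonzero entries being the weights of the amalgam.\<close>

subsection \<open>Clopen subsets of the Cantor space\<close>

definition cyl :: "cantor \<Rightarrow> nat \<Rightarrow> cantor set" where
  "cyl z n = {w. \<forall>i<n. w i = z i}"

text \<open>Finite sequences of length \<open>n\<close>, padded with \<open>False\<close>, give
  exactly one representative of each cylinder of level \<open>n\<close>.\<close>

definition reps :: "nat \<Rightarrow> cantor set" where
  "reps n = {z. \<forall>i\<ge>n. \<not> z i}"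

lemma finite_reps: "finite (reps n)"
proof -
  have "reps n \<subseteq> (\<lambda>S i. i \<in> S) ` Pow {..<n}"
  proof
    fix z assume "z \<in> reps n"
    then have "{i. z i} \<in> Pow {..<n}" by (force simp: reps_def not_le[symmetric])
    then show "z \<in> (\<lambda>S i. i \<in> S) ` Pow {..<n}" by (intro image_eqI[where x = "{i. z i}"]) auto
  qed
  then show ?thesis by (rule finite_subset) simp
qed

lemma mem_cyl_self [simp]: "z \<in> cyl z n"
  by (simp add: cyl_def)

lemma cyl_antimono: "m \<le> n \<Longrightarrow> cyl z n \<subseteq> cyl z m"
  by (auto simp: cyl_def)

lemma cyl_eq: "w \<in> cyl z n \<Longrightarrow> cyl w n = cyl z n"
  by (auto simp: cyl_def)

lemma rep_exists: "\<exists>w\<in>reps n. w \<in> cyl z n"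
  by (intro bexI[where x = "\<lambda>i. i < n \<and> z i"]) (auto simp: reps_def cyl_def)

lemma reps_unique: "\<lbrakk>z \<in> reps n; w \<in> reps n; w \<in> cyl z n\<rbrakk> \<Longrightarrow> w = z"
  by (rule ext) (auto simp: cyl_def reps_def not_le[symmetric])

lemma open_cyl: "open (cyl z n)"
proof -
  have "cyl z n = {f. \<forall>i\<in>{..<n}. f i \<in> {z i}}" by (auto simp: cyl_def)
  also have "open \<dots>"
    by (rule product_topology_basis'[where x = id, simplified]) (auto intro: Topological_Spaces.open_discrete)
  finally show ?thesis .
qed

lemma open_contains_cyl:
  assumes "open U" "z \<in> U"
  obtains n where "cyl z n \<subseteq> U"
proof -
  obtain X where X: "z \<in> (\<Pi>\<^sub>E i\<in>UNIV. X i)" "finite {i. X i \<noteq> UNIV}" "(\<Pi>\<^sub>E i\<in>UNIV. X i) \<subseteq> U"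
    using product_topology_open_contains_basis[of "\<lambda>i. euclidean" UNIV U z] assms
    by (auto simp: open_fun_def)
  define n where "n = Suc (Max (insert 0 {i. X i \<noteq> UNIV}))"
  have n: "i < n" if "X i \<noteq> UNIV" for i
    using that X(2) by (auto simp: n_def less_Suc_eq_le)
  have "cyl z n \<subseteq> (\<Pi>\<^sub>E i\<in>UNIV. X i)"
  proof
    fix w assume w: "w \<in> cyl z n"
    have "w i \<in> X i" for i
      using n[of i] w X(1) by (cases "X i = UNIV") (auto simp: cyl_def PiE_iff)
    then show "w \<in> (\<Pi>\<^sub>E i\<in>UNIV. X i)" by auto
  qed
  then have "cyl z n \<subseteq> U" using X(3) by (rule order_trans)
  then show ?thesis by (rule that)
qed

lemma compact_cantor: "compact (UNIV :: cantor set)"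
proof -
  have "compact (UNIV :: bool set)"
    by (rule finite_imp_compact) simp
  then have "compact_space (euclidean :: bool topology)"
    by (simp add: compact_space_def)
  then have "compact_space (product_topology (\<lambda>i. euclidean) UNIV :: cantor topology)"
    by (simp add: compact_space_product_topology)
  then show ?thesis
    by (simp add: compact_space_def euclidean_product_topology)
qed

text \<open>Compactness makes the length uniform: finitely many cylinders, each inside
  \<open>U\<close> or inside its complement, cover the space, and the largest of their lengths
  serves for every point. Conversely, a uniform length writes both \<open>U\<close> and its
  complement as unions of cylinders.\<close>

lemma clopen_iff: "clopen U \<longleftrightarrow> (\<exists>n. \<forall>z\<in>U. cyl z n \<subseteq> U)"
proof
  assume U: "clopen U"
  have "\<exists>n. cyl z n \<subseteq> U \<or> cyl z n \<subseteq> - U" for z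
    using open_contains_cyl[where U = U and z = z] open_contains_cyl[where U = "- U" and z = z] U
    unfolding clopen_def open_closed[of U] by (metis ComplI open_Compl open_closed)
  then obtain k where k: "cyl z (k z) \<subseteq> U \<or> cyl z (k z) \<subseteq> - U" for z by metis
  obtain F where F: "finite F" "UNIV \<subseteq> (\<Union>z\<in>F. cyl z (k z))"
    by (rule compactE_image[OF compact_cantor, where C = UNIV and f = "\<lambda>z. cyl z (k z)"])
      (auto simp: open_cyl intro: mem_cyl_self)
  define n where "n = Max (insert 0 (k ` F))"
  have "cyl z n \<subseteq> U" if "z \<in> U" for z
  proof -
    obtain y where y: "y \<in> F" "z \<in> cyl y (k y)" using F(2) by blast
    have "k y \<le> n" using y(1) F(1) by (simp add: n_def)
    then have "cyl z n \<subseteq> cyl y (k y)" using cyl_antimono cyl_eq[OF y(2)] by blast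
    then show ?thesis using k[of y] y(2) that by blast
  qed
  then show "\<exists>n. \<forall>z\<in>U. cyl z n \<subseteq> U" by blast
next
  assume "\<exists>n. \<forall>z\<in>U. cyl z n \<subseteq> U"
  then obtain n where n: "\<And>z. z \<in> U \<Longrightarrow> cyl z n \<subseteq> U" by blast
  have "U = (\<Union>z\<in>U. cyl z n)" using n mem_cyl_self by blast
  moreover have "- U = (\<Union>z\<in>-U. cyl z n)"
  proof -
    have "cyl z n \<subseteq> - U" if "z \<notin> U" for z
    proof
      fix w assume w: "w \<in> cyl z n"
      then have "z \<in> cyl w n" by (simp add: cyl_def)
      then show "w \<in> - U" using n[of w] that by blast
    qed
    then show ?thesis using mem_cyl_self by blast
  qed
  moreover have "open (\<Union>z\<in>A. cyl z n)" for A by (intro open_UN ballI open_cyl)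
  ultimately have "open U" "open (- U)" by metis+
  then show "clopen U" by (simp add: clopen_def closed_def)
qed

lemma clopen_empty [simp]: "clopen {}" and clopen_UNIV [simp]: "clopen UNIV"
  by (simp_all add: clopen_def)

lemma clopen_cyl [simp]: "clopen (cyl z n)"
  unfolding clopen_iff by (rule exI[where x = n]) (simp add: cyl_eq)

lemma clopen_Un: "clopen U \<Longrightarrow> clopen W \<Longrightarrow> clopen (U \<union> W)"
  and clopen_Int: "clopen U \<Longrightarrow> clopen W \<Longrightarrow> clopen (U \<inter> W)"
  and clopen_Diff: "clopen U \<Longrightarrow> clopen W \<Longrightarrow> clopen (U - W)"
  by (simp_all add: clopen_def open_Un closed_Un open_Int closed_Int open_Diff closed_Diff)

lemma clopen_coordinate [simp]: "clopen {w. w n}"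
proof -
  have "\<forall>z\<in>{w. w n}. cyl z (Suc n) \<subseteq> {w. w n}" by (auto simp: cyl_def)
  then show ?thesis unfolding clopen_iff by blast
qed

lemma clopen_eq_UN_cyl:
  assumes "clopen U"
  obtains n where "U = (\<Union>z\<in>reps n \<inter> U. cyl z n)"
proof -
  obtain n where n: "\<And>z. z \<in> U \<Longrightarrow> cyl z n \<subseteq> U" using assms unfolding clopen_iff by blast
  have "z \<in> (\<Union>z\<in>reps n \<inter> U. cyl z n)" if z: "z \<in> U" for z
  proof -
    obtain w where w: "w \<in> reps n" "w \<in> cyl z n" using rep_exists by blast
    then have "w \<in> U" "z \<in> cyl w n" using n[OF z] by (auto simp: cyl_def)
    then show ?thesis using w(1) by blast
  qed
  then show ?thesis using n by (intro that[of n] equalityI subsetI) auto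
qed

section \<open>Clopen sets as generators of the Borel sets\<close>

lemma countable_clopen: "countable {U. clopen U}"
proof -
  have "{U. clopen U} \<subseteq> (\<Union>n. (\<lambda>S. \<Union>z\<in>S. cyl z n) ` Pow (reps n))"
    by (auto elim!: clopen_eq_UN_cyl)
  moreover have "countable \<dots>"
    by (intro countable_UN countable_image) (auto simp: finite_reps countable_finite)
  ultimately show ?thesis by (rule countable_subset)
qed

text \<open>An open set is the union of the clopen sets inside it, because these include cylinders
  around each of its points. This union is countable.\<close>

lemma sets_borel_cantor: "sets (borel :: cantor measure) = sigma_sets UNIV {U. clopen U}"
proof
  have "U \<in> sigma_sets UNIV {U. clopen U}" if "open U" for U :: "cantor set"
  proof -
    have "U \<subseteq> \<Union>{W. clopen W \<and> W \<subseteq> U}"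
    proof
      fix z assume "z \<in> U"
      then obtain n where "cyl z n \<subseteq> U" using open_contains_cyl[OF \<open>open U\<close>] by metis
      then show "z \<in> \<Union>{W. clopen W \<and> W \<subseteq> U}" by (intro UnionI[of "cyl z n"]) simp_all
    qed
    then have "U = \<Union>{W. clopen W \<and> W \<subseteq> U}" by (intro equalityI) auto
    moreover have "\<Union>{W. clopen W \<and> W \<subseteq> U} \<in> sigma_sets UNIV {U. clopen U}"
      by (rule sigma_sets_UNION) (auto intro: countable_subset[OF _ countable_clopen])
    ultimately show ?thesis by metis
  qed
  then show "sets (borel :: cantor measure) \<subseteq> sigma_sets UNIV {U. clopen U}"
    unfolding borel_def by (auto intro!: sigma_sets_mono)
  show "sigma_sets UNIV {U. clopen U} \<subseteq> sets (borel :: cantor measure)"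
    using sets.sigma_sets_subset[of "{U. clopen U}" "borel :: cantor measure"]
    by (simp add: clopen_def subset_iff)
qed

text \<open>The clopen sets form an intersection-stable generator containing the whole space, so
  uniqueness of finite measures on such a generator applies.\<close>

lemma borel_measure_eqI_clopen:
  fixes M N :: "cantor measure"
  assumes "sets M = sets borel" "sets N = sets borel" "emeasure M UNIV \<noteq> \<infinity>"
    and "\<And>U. clopen U \<Longrightarrow> emeasure M U = emeasure N U"
  shows "M = N"
  by (rule measure_eqI_generator_eq[where E = "{U. clopen U}" and \<Omega> = UNIV and A = "\<lambda>_. UNIV"])
    (use assms in \<open>auto simp: sets_borel_cantor Int_stable_def clopen_Int\<close>)

lemma continuous_on_clopen_vimage:
  assumes "\<And>n. clopen {z. \<phi> z n}"
  shows "continuous_on UNIV (\<phi> :: cantor \<Rightarrow> cantor)"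
proof (rule continuous_on_coordinatewise_then_product)
  fix n
  have "open ((\<lambda>z. \<phi> z n) -` B)" for B
  proof -
    have "(\<lambda>z. \<phi> z n) -` B = (if True \<in> B then {z. \<phi> z n} else {}) \<union> (if False \<in> B then - {z. \<phi> z n} else {})"
      (is "?L = ?R")
    proof (rule set_eqI)
      fix z show "z \<in> ?L \<longleftrightarrow> z \<in> ?R" by (cases "\<phi> z n") auto
    qed
    moreover have "open {z. \<phi> z n}" "open (- {z. \<phi> z n})"
      using assms[of n] by (auto simp only: clopen_def open_Compl)
    ultimately show ?thesis by auto
  qed
  then show "continuous_on UNIV (\<lambda>z. \<phi> z n)"
    by (simp add: continuous_on_open_vimage)
qed

lemma clopen_in_borel: "clopen U \<Longrightarrow> U \<in> sets borel"
  by (simp add: clopen_def)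

lemma clopen_vimage:
  assumes "continuous_on UNIV \<phi>" "clopen U"
  shows "clopen (\<phi> -` U)"
  using assms open_vimage closed_vimage unfolding clopen_def by blast

lemma emeasure_shift:
  fixes A :: "real set"
  assumes "A \<in> sets borel"
  shows "emeasure lborel ((+) c ` A) = emeasure lborel A"
proof -
  have "emeasure lborel ((+) c ` A) = emeasure (distr lborel borel ((+) (- c))) A"
    using assms by (subst emeasure_distr)
      (auto simp: vimage_def intro!: arg_cong[where f = "emeasure lborel"] image_eqI[where x = "_ - c"])
  then show ?thesis by (simp only: lborel_distr_plus)
qed

subsection \<open>Coding the unit interval\<close>

locale group_like_set =
  fixes V :: "real set"
  assumes group_like: "group_like V"
begin

section \<open>Arithmetic and density of a group-like set\<close>

lemma countable_V: "countable V" and infinite_V: "infinite V"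
  and zero_in_V [simp]: "0 \<in> V" and one_in_V [simp]: "1 \<in> V"
  and V_ge_0: "v \<in> V \<Longrightarrow> 0 \<le> v" and V_le_1: "v \<in> V \<Longrightarrow> v \<le> 1"
  using group_like by (auto simp: group_like_def)

text \<open>Membership in \<open>V\<close> thereby splits into group arithmetic and bounds. If
  \<open>u + k\<close> and \<open>u\<close> both lie in the unit interval, the integer
  \<open>k\<close> is 0, 1 or -1, and the last two values force \<open>u + k\<close> to be the
  endpoint 1 or 0.\<close>

lemma V_iff: "v \<in> V \<longleftrightarrow> v \<in> V + \<int> \<and> 0 \<le> v \<and> v \<le> 1"
proof (intro iffI conjI)
  assume "v \<in> V"
  then show "v \<in> V + \<int>" using set_plus_intro[of v V 0 \<int>] by simp
next
  assume *: "v \<in> V + \<int> \<and> 0 \<le> v \<and> v \<le> 1"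
  then obtain u k where "u \<in> V" and v: "v = u + of_int k" by (auto elim!: set_plus_elim Ints_cases)
  then have u: "0 \<le> u" "u \<le> 1" by (auto intro: V_ge_0 V_le_1)
  then have "-1 \<le> real_of_int k" "real_of_int k \<le> 1" using * v by linarith+
  then consider "k = 0" | "k = 1" | "k = -1" by linarith
  then show "v \<in> V"
  proof cases
    case 2
    then have "v = 1" using * u v by auto
    then show ?thesis by simp
  next
    case 3
    then have "v = 0" using * u v by auto
    then show ?thesis by simp
  qed (use \<open>u \<in> V\<close> v in auto)
qed (auto intro: V_ge_0 V_le_1)

lemma group_add: "a \<in> V + \<int> \<Longrightarrow> b \<in> V + \<int> \<Longrightarrow> a + b \<in> V + \<int>"
  and group_minus: "a \<in> V + \<int> \<Longrightarrow> b \<in> V + \<int> \<Longrightarrow> a - b \<in> V + \<int>"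
  using group_like unfolding group_like_def additive_subgroup_real_def
  by (blast, metis diff_conv_add_uminus)

lemma V_diff: "a \<in> V \<Longrightarrow> b \<in> V \<Longrightarrow> a \<le> b \<Longrightarrow> b - a \<in> V"
  and V_add: "a \<in> V \<Longrightarrow> b \<in> V \<Longrightarrow> a + b \<le> 1 \<Longrightarrow> a + b \<in> V"
  by (auto simp: V_iff intro: group_add group_minus)

lemma V_sum: "(\<And>i. i \<in> I \<Longrightarrow> f i \<in> V) \<Longrightarrow> sum f I \<le> 1 \<Longrightarrow> sum f I \<in> V"
proof (induction I rule: infinite_finite_induct)
  case (insert x I)
  have "0 \<le> f x" using insert.prems(1) by (auto intro: V_ge_0)
  then have "sum f I \<in> V" using insert by (intro insert.IH) auto
  then show ?case using insert by (auto intro: V_add)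
qed auto

text \<open>By the pigeonhole principle two elements of \<open>V\<close> are at distance less than \<open>b - a\<close>, and their
  difference is again in \<open>V\<close>.\<close>

lemma V_dense:
  assumes "a \<in> V" "b \<in> V" "a < b"
  obtains c where "c \<in> V" "a < c" "c < b"
proof -
  define e where "e = b - a"
  have e: "e > 0" using assms by (simp add: e_def)
  have "(\<lambda>v. \<lfloor>v / e\<rfloor>) ` V \<subseteq> {0..\<lfloor>1 / e\<rfloor>}"
    using e V_ge_0 V_le_1 by (auto intro!: floor_mono divide_right_mono)
  then have "finite ((\<lambda>v. \<lfloor>v / e\<rfloor>) ` V)" by (rule finite_subset) simp
  then have "\<not> inj_on (\<lambda>v. \<lfloor>v / e\<rfloor>) V" using infinite_V finite_imageD by blast
  then obtain u v where uv: "u \<in> V" "v \<in> V" "u < v" "\<lfloor>u / e\<rfloor> = \<lfloor>v / e\<rfloor>"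
    unfolding inj_on_def by (metis linorder_neqE_linordered_idom)
  then have "v / e - u / e < 1" by linarith
  then have "v - u < e" using e by (simp add: diff_divide_distrib[symmetric])
  moreover have "v - u \<in> V" using uv by (auto intro: V_diff)
  ultimately have "a + (v - u) \<in> V" "a + (v - u) < b"
    using assms(1) V_le_1[OF assms(2)] by (auto simp: e_def intro: V_add)
  then show ?thesis using that uv(3) by simp
qed

section \<open>Dyadic subdivision at the points of a group-like set\<close>

definition enum :: "nat \<Rightarrow> real" where
  "enum = from_nat_into V"

lemma range_enum: "range enum = V"
  using zero_in_V countable_V unfolding enum_def by (metis empty_iff range_from_nat_into)

lemma enum_in_V [simp]: "enum k \<in> V"
  using range_enum by blast

text \<open>Choosing the first enumerated point inside the interval, rather than an arbitrary one,
  guarantees that no point of \<open>V\<close> is postponed forever. \<open>V_dense\<close> supplies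
  such a point whenever the endpoints are distinct elements of \<open>V\<close> in increasing
  order.\<close>

definition index :: "real \<times> real \<Rightarrow> nat" where
  "index p = (LEAST k. fst p < enum k \<and> enum k < snd p)"

definition mid :: "real \<times> real \<Rightarrow> real" where
  "mid p = enum (index p)"

lemma
  assumes "fst p \<in> V" "snd p \<in> V" "fst p < snd p"
  shows mid_gt: "fst p < mid p" and mid_lt: "mid p < snd p"
proof -
  obtain c where "c \<in> V" "fst p < c" "c < snd p" using V_dense[OF assms] .
  then have "\<exists>k. fst p < enum k \<and> enum k < snd p" using range_enum by (metis imageE)
  from LeastI_ex[OF this] show "fst p < mid p" "mid p < snd p"
    by (simp_all add: mid_def index_def)
qed

definition half :: "bool \<Rightarrow> real \<times> real \<Rightarrow> real \<times> real" where
  "half b p = (if b then (mid p, snd p) else (fst p, mid p))"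

primrec interval :: "cantor \<Rightarrow> nat \<Rightarrow> real \<times> real" where
  "interval z 0 = (0, 1)"
| "interval z (Suc n) = half (z n) (interval z n)"

abbreviation "lo z n \<equiv> fst (interval z n)"
abbreviation "hi z n \<equiv> snd (interval z n)"

lemma lo_in_V: "lo z n \<in> V" and hi_in_V: "hi z n \<in> V" and lo_less_hi: "lo z n < hi z n"
proof -
  have "lo z n \<in> V \<and> hi z n \<in> V \<and> lo z n < hi z n"
    by (induction n) (auto simp: half_def mid_gt mid_lt, auto simp: mid_def)
  then show "lo z n \<in> V" "hi z n \<in> V" "lo z n < hi z n" by auto
qed

lemma interval_cong: "w \<in> cyl z n \<Longrightarrow> interval w n = interval z n"
  by (induction n) (auto simp: cyl_def)

text \<open>After \<open>n\<close> steps the first \<open>n\<close> elements of the enumeration have become division points.\<close>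

lemma le_index: "lo z n < enum k \<Longrightarrow> enum k < hi z n \<Longrightarrow> n \<le> k"
proof (induction n arbitrary: k)
  case (Suc n)
  let ?p = "interval z n"
  have p: "fst ?p < mid ?p" "mid ?p < snd ?p"
    by (simp_all add: mid_gt mid_lt lo_in_V hi_in_V lo_less_hi)
  have k: "fst ?p < enum k" "enum k < snd ?p" "enum k \<noteq> mid ?p"
    using Suc.prems p by (auto simp: half_def split: if_splits)
  then have "n \<le> k" "index ?p \<le> k"
    using Suc.IH by (auto simp: index_def intro: Least_le)
  \<comment> \<open>The induction hypothesis is used a second time, for the midpoint itself. With
    \<open>index ?p\<close> below \<open>k\<close> and different from it, this leaves room for
    \<open>Suc n\<close>.\<close>
  moreover have "n \<le> index ?p" using Suc.IH[of "index ?p"] p by (simp add: mid_def)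
  moreover have "index ?p \<noteq> k" using k(3) by (auto simp: mid_def)
  ultimately show ?case by simp
qed simp

section \<open>The coding map\<close>

primrec locate :: "real \<Rightarrow> nat \<Rightarrow> real \<times> real" where
  "locate t 0 = (0, 1)"
| "locate t (Suc n) = half (mid (locate t n) \<le> t) (locate t n)"

text \<open>The search \<open>locate\<close> is a recursion of its own because
  \<open>interval\<close> needs the sequence in advance; \<open>interval_code\<close> identifies the
  two afterwards. Ties go to the right, in agreement with half-open intervals, so a doubled point is
  coded by its right-hand copy.\<close>

definition code :: "real \<Rightarrow> cantor" where
  "code t n \<longleftrightarrow> mid (locate t n) \<le> t"

lemma interval_code: "interval (code t) n = locate t n"
  by (induction n) (auto simp: code_def)

text \<open>This is the trace of \<open>U\<close> on the coded points, pulled back to the unit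
  interval. Questions about clopen sets are settled there, where cylinders become half-open
  intervals.\<close>

definition pre :: "cantor set \<Rightarrow> real set" where
  "pre U = {t \<in> {0..<1}. code t \<in> U}"

lemma pre_cyl: "pre (cyl z n) = {lo z n..<hi z n}"
proof (induction n)
  case 0
  show ?case by (auto simp: pre_def cyl_def)
next
  case (Suc n)
  let ?p = "interval z n"
  have step: "t \<in> pre (cyl z (Suc n)) \<longleftrightarrow> t \<in> pre (cyl z n) \<and> (mid ?p \<le> t \<longleftrightarrow> z n)" for t
  proof -
    have "t \<in> pre (cyl z (Suc n)) \<longleftrightarrow> t \<in> pre (cyl z n) \<and> (code t n \<longleftrightarrow> z n)"
      by (auto simp: pre_def cyl_def less_Suc_eq)
    \<comment> \<open>Inside the cylinder the search for \<open>t\<close> has reached the same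
      interval as \<open>z\<close>, so the next bit compares \<open>t\<close> with the same
      midpoint.\<close>
    moreover have "code t n \<longleftrightarrow> mid ?p \<le> t" if "t \<in> pre (cyl z n)"
      using interval_cong[of "code t" z n] that
      by (simp add: pre_def code_def interval_code[symmetric])
    ultimately show ?thesis by blast
  qed
  have "fst ?p < mid ?p" "mid ?p < snd ?p"
    by (simp_all add: mid_gt mid_lt lo_in_V hi_in_V lo_less_hi)
  then show ?case
    unfolding set_eq_iff step Suc.IH by (cases "z n") (auto simp: half_def)
qed

lemma pre_empty [simp]: "pre {} = {}" and pre_UNIV [simp]: "pre UNIV = {0..<1}"
  and pre_Un: "pre (U \<union> W) = pre U \<union> pre W"
  and pre_Int: "pre (U \<inter> W) = pre U \<inter> pre W"
  and pre_Diff: "pre (U - W) = pre U - pre W"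
  and pre_UN: "pre (\<Union>i\<in>I. F i) = (\<Union>i\<in>I. pre (F i))"
  by (auto simp: pre_def)

lemma pre_subset: "pre U \<subseteq> {0..<1}"
  by (auto simp: pre_def)

text \<open>The image of \<open>code\<close> is dense, so a clopen set is determined by its trace on it.\<close>

lemma pre_eq_empty:
  assumes "open U" "pre U = {}"
  shows "U = {}"
proof (rule ccontr)
  assume "U \<noteq> {}"
  then obtain z n where "cyl z n \<subseteq> U" using open_contains_cyl[OF assms(1)] by (metis equals0I)
  then have "{lo z n..<hi z n} \<subseteq> pre U" unfolding pre_cyl[symmetric] by (auto simp: pre_def)
  then show False using assms(2) lo_less_hi[of z n] by simp
qed

lemma pre_inject:
  assumes "clopen U" "clopen W" "pre U = pre W"
  shows "U = W"
proof -
  have "open (U - W)" "open (W - U)"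
    using assms by (auto simp: clopen_def intro: open_Diff)
  moreover have "pre (U - W) = {}" "pre (W - U) = {}" using assms(3) by (simp_all add: pre_Diff)
  ultimately have "U - W = {}" "W - U = {}" using pre_eq_empty by metis+
  then show ?thesis by blast
qed

text \<open>The point \<open>v\<close> is a division point from some level on, so each interval of
  that level lies entirely on one side of \<open>v\<close>. Collecting those on the left gives a set
  decided by finitely many coordinates.\<close>

lemma initial_clopen:
  assumes "v \<in> V"
  obtains C where "clopen C" "pre C = {0..<v}"
proof -
  obtain k where k: "enum k = v" using assms range_enum by (metis imageE)
  \<comment> \<open>If \<open>v\<close> were interior to an interval of level \<open>Suc k\<close>,
    then \<open>le_index\<close> would give \<open>Suc k \<le> k\<close>; level \<open>k\<close>
    would not yield this contradiction.\<close>
  define C where "C = {z. hi z (Suc k) \<le> v}"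
  have "clopen C"
    unfolding clopen_iff by (rule exI[where x = "Suc k"]) (auto simp: C_def dest: interval_cong)
  moreover have "pre C = {0..<v}"
  proof -
    have "hi (code t) (Suc k) \<le> v \<longleftrightarrow> t < v" if "t \<in> {0..<1}" for t
    proof -
      have "t \<in> pre (cyl (code t) (Suc k))" using that by (simp add: pre_def)
      then have "lo (code t) (Suc k) \<le> t" "t < hi (code t) (Suc k)"
        unfolding pre_cyl by (simp_all del: interval.simps)
      moreover have "\<not> (lo (code t) (Suc k) < v \<and> v < hi (code t) (Suc k))"
        using le_index[of "code t" "Suc k" k] k by (auto simp del: interval.simps)
      ultimately show ?thesis by linarith
    qed
    then show ?thesis using V_le_1[OF assms] by (auto simp: pre_def C_def simp del: interval.simps)
  qed
  ultimately show ?thesis by (rule that)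
qed

section \<open>The algebra of traces of clopen sets\<close>

definition traces :: "real set set" where
  "traces = pre ` {U. clopen U}"

lemma traces_Un: "A \<in> traces \<Longrightarrow> B \<in> traces \<Longrightarrow> A \<union> B \<in> traces"
  and traces_Int: "A \<in> traces \<Longrightarrow> B \<in> traces \<Longrightarrow> A \<inter> B \<in> traces"
  and traces_Diff: "A \<in> traces \<Longrightarrow> B \<in> traces \<Longrightarrow> A - B \<in> traces"
  unfolding traces_def
  by (auto simp: pre_Un[symmetric] pre_Int[symmetric] pre_Diff[symmetric]
      intro!: imageI clopen_Un clopen_Int clopen_Diff)

lemma empty_in_traces [simp]: "{} \<in> traces"
  unfolding traces_def by (metis pre_empty clopen_empty mem_Collect_eq imageI)

lemma traces_UN: "finite I \<Longrightarrow> (\<And>i. i \<in> I \<Longrightarrow> A i \<in> traces) \<Longrightarrow> (\<Union>i\<in>I. A i) \<in> traces"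
  by (induction I rule: finite_induct) (auto intro: traces_Un)

lemma Ico_in_traces:
  assumes "a \<in> V" "b \<in> V"
  shows "{a..<b} \<in> traces"
proof -
  have "{0..<a} \<in> traces" "{0..<b} \<in> traces"
    using initial_clopen[OF assms(1)] initial_clopen[OF assms(2)] by (metis imageI mem_Collect_eq traces_def)+
  moreover have "{a..<b} = {0..<b} - {0..<a}" using V_ge_0[OF assms(1)] by auto
  ultimately show ?thesis by (simp add: traces_Diff)
qed

text \<open>All intervals are taken from one level \<open>n\<close>, where distinct representatives
  have disjoint cylinders; this makes the lengths add up.\<close>

lemma traces_eq_UN_Ico:
  assumes "A \<in> traces"
  obtains S n where "finite S" "A = (\<Union>z\<in>S. {lo z n..<hi z n})"
    "disjoint_family_on (\<lambda>z. {lo z n..<hi z n}) S"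
proof -
  obtain U where U: "clopen U" "A = pre U" using assms by (auto simp: traces_def)
  then obtain n where n: "U = (\<Union>z\<in>reps n \<inter> U. cyl z n)" using clopen_eq_UN_cyl by metis
  have "A = (\<Union>z\<in>reps n \<inter> U. {lo z n..<hi z n})"
    using n U(2) by (metis (no_types, lifting) SUP_cong pre_UN pre_cyl)
  moreover have "disjoint_family_on (\<lambda>z. {lo z n..<hi z n}) (reps n \<inter> U)"
    unfolding disjoint_family_on_def pre_cyl[symmetric]
  proof (intro ballI impI)
    fix z w assume zw: "z \<in> reps n \<inter> U" "w \<in> reps n \<inter> U" "z \<noteq> w"
    have "cyl z n \<inter> cyl w n = {}"
      using zw reps_unique[of z n w] by (force simp: cyl_def)
    then show "pre (cyl z n) \<inter> pre (cyl w n) = {}" by (simp add: pre_Int[symmetric])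
  qed
  ultimately show ?thesis using finite_reps that by blast
qed

subsection \<open>The split interval measure\<close>

lemma trace_borel [measurable]: "A \<in> traces \<Longrightarrow> A \<in> sets borel"
  by (auto elim!: traces_eq_UN_Ico)

lemma trace_subset: "A \<in> traces \<Longrightarrow> A \<subseteq> {0..<1}"
  using pre_subset by (auto simp: traces_def)

lemma measure_UN_interval:
  assumes "finite S" "disjoint_family_on (\<lambda>z. {lo z n..<hi z n}) S"
  shows "measure lborel (\<Union>z\<in>S. {lo z n..<hi z n}) = (\<Sum>z\<in>S. hi z n - lo z n)"
proof -
  have "measure lborel {lo z n..<hi z n} = hi z n - lo z n" "emeasure lborel {lo z n..<hi z n} \<noteq> \<infinity>" for z
    using lo_less_hi[of z n] by simp_all
  then show ?thesis
    using assms by (subst measure_finite_Union) auto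
qed

lemma measure_trace_le_1: "A \<in> traces \<Longrightarrow> measure lborel A \<le> 1"
  using measure_mono_fmeasurable[of A "{0..<1}" lborel] trace_subset by (auto simp: fmeasurable_def)

text \<open>Each interval length is a difference of elements of \<open>V\<close>. Their sum stays in
  \<open>V\<close> because it is at most 1.\<close>

lemma measure_trace_in_V:
  assumes "A \<in> traces"
  shows "measure lborel A \<in> V"
proof (rule traces_eq_UN_Ico[OF assms])
  fix S n
  assume "finite S" "A = (\<Union>z\<in>S. {lo z n..<hi z n})" "disjoint_family_on (\<lambda>z. {lo z n..<hi z n}) S"
  then have "measure lborel A = (\<Sum>z\<in>S. hi z n - lo z n)" by (simp add: measure_UN_interval)
  then show ?thesis
    using measure_trace_le_1[OF assms]
    by (auto intro!: V_sum V_diff less_imp_le lo_less_hi lo_in_V hi_in_V)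
qed

definition split_measure :: "cantor measure" where
  "split_measure = distr (restrict_space lborel {0..<1}) borel code"

text \<open>It suffices to test the clopen generators, whose preimages are traces and hence finite
  unions of intervals.\<close>

lemma measurable_code: "code \<in> restrict_space lborel {0..<1} \<rightarrow>\<^sub>M borel"
proof (rule measurable_sigma_sets[OF sets_borel_cantor])
  fix U assume "U \<in> {U. clopen U}"
  then have "pre U \<in> traces" by (simp add: traces_def)
  moreover have "code -` U \<inter> space (restrict_space lborel {0..<1}) = pre U"
    by (auto simp: pre_def space_restrict_space)
  ultimately show "code -` U \<inter> space (restrict_space lborel {0..<1}) \<in> sets (restrict_space lborel {0..<1})"
    by (simp add: sets_restrict_space_iff trace_subset)
qed auto

lemma sets_split_measure [simp]: "sets split_measure = sets borel"
  and space_split_measure [simp]: "space split_measure = UNIV"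
  by (simp_all add: split_measure_def)

lemma emeasure_split_measure:
  assumes "U \<in> sets borel"
  shows "emeasure split_measure U = emeasure lborel (pre U)"
proof -
  have "code -` U \<inter> space (restrict_space lborel {0..<1}) = pre U"
    by (auto simp: pre_def space_restrict_space)
  then show ?thesis
    using assms unfolding split_measure_def
    by (simp add: emeasure_distr measurable_code emeasure_restrict_space pre_subset)
qed

lemma measure_split_measure: "U \<in> sets borel \<Longrightarrow> measure split_measure U = measure lborel (pre U)"
  by (simp add: measure_def emeasure_split_measure)

lemma pre_in_traces: "clopen U \<Longrightarrow> pre U \<in> traces"
  by (simp add: traces_def)

lemma borel_prob_split_measure: "borel_prob split_measure"
proof -
  have "emeasure split_measure (space split_measure) = 1" by (simp add: emeasure_split_measure)
  then show ?thesis by (simp add: borel_prob_def prob_spaceI)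
qed

lemma full_measure_split_measure: "full_measure split_measure"
  unfolding full_measure_def
proof (intro allI impI)
  fix U :: "cantor set" assume U: "open U \<and> U \<noteq> {}"
  then obtain z n where zn: "cyl z n \<subseteq> U" using open_contains_cyl[of U] by (metis equals0I)
  interpret prob_space split_measure using borel_prob_split_measure by (simp add: borel_prob_def)
  have "0 < measure split_measure (cyl z n)"
    using lo_less_hi[of z n] by (simp add: measure_split_measure open_cyl pre_cyl)
  also have "\<dots> \<le> measure split_measure U" using zn U by (intro finite_measure_mono) auto
  finally show "measure split_measure U > 0" .
qed

lemma clopen_values_split_measure: "clopen_values split_measure = V"
proof
  show "clopen_values split_measure \<subseteq> V"
    by (auto simp: clopen_values_def measure_split_measure clopen_in_borel measure_trace_in_V pre_in_traces)
  show "V \<subseteq> clopen_values split_measure"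
  proof
    fix v assume v: "v \<in> V"
    then obtain C where "clopen C" "pre C = {0..<v}" by (rule initial_clopen)
    then show "v \<in> clopen_values split_measure"
      unfolding clopen_values_def using V_ge_0[OF v]
      by (auto simp: measure_split_measure clopen_in_borel intro!: exI[where x = C])
  qed
qed

text \<open>The unit interval is cut at the partial sums of the weights. These lie in
  \<open>V\<close>, so each piece is the trace of a clopen set.\<close>

lemma clopen_partition_of_weights:
  fixes v :: "nat \<Rightarrow> real"
  assumes v: "\<And>i. i < n \<Longrightarrow> v i \<in> V \<and> v i \<noteq> 0" and sum: "(\<Sum>i<n. v i) = 1"
  obtains x where "inj_on x {..<n}" "clopen_partition (x ` {..<n})" "\<And>i. i < n \<Longrightarrow> measure split_measure (x i) = v i"
proof -
  define s where "s i = (\<Sum>j<i. v j)" for i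
  have v0: "0 < v i" if "i < n" for i using v[OF that] V_ge_0[of "v i"] by linarith
  have s_Suc: "s (Suc i) = s i + v i" for i by (simp add: s_def)
  have s_mono: "s i \<le> s j" if "i \<le> j" "j \<le> n" for i j
    unfolding s_def using that v0 by (intro sum_mono2) (auto intro: less_imp_le)
  have s_V: "s i \<in> V" if "i \<le> n" for i
    using s_mono[of i n] sum v that by (auto simp: s_def intro!: V_sum)
  have "\<exists>U. clopen U \<and> pre U = {s i..<s (Suc i)}" if "i < n" for i
    using Ico_in_traces[of "s i" "s (Suc i)"] s_V that by (auto simp: traces_def)
  then obtain x where x: "\<And>i. i < n \<Longrightarrow> clopen (x i)" "\<And>i. i < n \<Longrightarrow> pre (x i) = {s i..<s (Suc i)}"
    by metis
  have disj: "x i \<inter> x j = {}" if "i < j" "j < n" for i j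
  \<comment> \<open>Disjointness, like the covering property below, is checked on traces, which
    determine clopen sets.\<close>
  proof (rule pre_eq_empty)
    show "open (x i \<inter> x j)" using x(1) that by (auto simp: clopen_def)
    show "pre (x i \<inter> x j) = {}"
      using x(2)[of i] x(2)[of j] s_mono[of "Suc i" j] that by (auto simp: pre_Int)
  qed
  have ne: "x i \<noteq> {}" if "i < n" for i
  proof
    assume "x i = {}"
    then have "{s i..<s (Suc i)} = {}" using x(2)[OF that] by simp
    then show False using v0[OF that] by (simp add: s_Suc)
  qed
  have un: "(\<Union>i<n. x i) = UNIV"
  proof (rule pre_inject)
    have "(\<Union>i<m. {s i..<s (Suc i)}) = {0..<s m}" if "m \<le> n" for m
      using that
    proof (induction m)
      case (Suc m)
      then have "0 \<le> s m" "s m \<le> s (Suc m)" using s_mono[of 0 m] s_mono[of m "Suc m"] by (simp_all add: s_def)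
      then show ?case using Suc by (simp add: lessThan_Suc ivl_disj_un_two(3) Un_commute)
    qed (simp add: s_def)
    then have "(\<Union>i<n. {s i..<s (Suc i)}) = {0..<1}" using sum by (simp add: s_def)
    moreover have "pre (\<Union>i<n. x i) = (\<Union>i<n. {s i..<s (Suc i)})" using x(2) by (simp add: pre_UN)
    ultimately show "pre (\<Union>i<n. x i) = pre UNIV" by simp
    show "clopen (\<Union>i<n. x i)"
      using x(1) unfolding clopen_def by (intro conjI open_UN closed_UN) auto
  qed simp
  show ?thesis
  proof (rule that)
    have d: "x i \<inter> x j = {}" if "i \<noteq> j" "i < n" "j < n" for i j
      using disj[of i j] disj[of j i] that by (cases "i < j") (auto simp: Int_commute)
    show "inj_on x {..<n}"
    proof (rule inj_onI, rule ccontr)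
      fix i j assume "i \<in> {..<n}" "j \<in> {..<n}" "x i = x j" "i \<noteq> j"
      then show False using d[of i j] ne[of i] by simp
    qed
    have "partition_on UNIV (x ` {..<n})"
      unfolding partition_on_def
    proof (intro conjI)
      show "disjoint (x ` {..<n})"
        unfolding disjoint_def using d by (metis imageE lessThan_iff)
      show "{} \<notin> x ` {..<n}" using ne by force
    qed (simp add: un)
    then show "clopen_partition (x ` {..<n})"
      using x(1) by (auto simp: clopen_partition_def)
    show "measure split_measure (x i) = v i" if "i < n" for i
      using x[OF that] v0[OF that] by (simp add: measure_split_measure clopen_in_borel s_Suc)
  qed
qed

lemma maximal_measure_split_measure: "maximal_measure split_measure"
  unfolding maximal_measure_def clopen_values_split_measure
proof (intro conjI allI impI ballI)
  fix n :: nat and v :: "nat \<Rightarrow> real"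
  assume "(\<forall>i<n. v i \<in> V \<and> v i \<noteq> 0) \<and> (\<Sum>i<n. v i) = 1"
  then show "\<exists>x. inj_on x {..<n} \<and> clopen_partition (x ` {..<n}) \<and> (\<forall>i<n. measure split_measure (x i) = v i)"
    using clopen_partition_of_weights[of n v] by metis
next
  fix v w assume "v \<in> V" "w \<in> V"
  then show "\<bar>v - w\<bar> \<in> V" by (cases "v \<le> w") (auto simp: abs_if V_diff)
qed

subsection \<open>Interval exchanges\<close>

text \<open>This keeps only what is needed of a piecewise translation: traces correspond in both
  directions and lengths are preserved. Composition, inversion and gluing then require no
  bookkeeping of breakpoints.\<close>

definition exchange :: "(real \<Rightarrow> real) \<Rightarrow> real set \<Rightarrow> real set \<Rightarrow> bool" where
  "exchange T X Y \<longleftrightarrow> bij_betw T X Y \<and> (\<forall>A\<subseteq>X. (T ` A \<in> traces \<longleftrightarrow> A \<in> traces) \<and>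
     (A \<in> traces \<longrightarrow> emeasure lborel (T ` A) = emeasure lborel A))"

lemma exchange_traces: "exchange T X Y \<Longrightarrow> A \<subseteq> X \<Longrightarrow> T ` A \<in> traces \<longleftrightarrow> A \<in> traces"
  and exchange_emeasure: "exchange T X Y \<Longrightarrow> A \<subseteq> X \<Longrightarrow> A \<in> traces \<Longrightarrow> emeasure lborel (T ` A) = emeasure lborel A"
  unfolding exchange_def by blast+

lemma exchange_trans:
  assumes "exchange T X Y" "exchange S Y Z"
  shows "exchange (S \<circ> T) X Z"
proof -
  have "T ` A \<subseteq> Y" if "A \<subseteq> X" for A using assms(1) that by (auto simp: exchange_def bij_betw_def)
  then show ?thesis
    using assms unfolding exchange_def image_comp[symmetric] by (auto intro: bij_betw_trans)
qed

lemma exchange_sym: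
  assumes "exchange T X Y"
  shows "exchange (inv_into X T) Y X"
proof -
  have bij: "bij_betw T X Y" using assms by (simp add: exchange_def)
  have "inv_into X T ` B \<subseteq> X \<and> T ` inv_into X T ` B = B" if "B \<subseteq> Y" for B
    using bij_betw_inv_into[OF bij] that bij by (auto simp: bij_betw_def image_inv_into_cancel)
  then show ?thesis
    using assms bij_betw_inv_into[OF bij] unfolding exchange_def by metis
qed

text \<open>A subset is cut along \<open>X\<close> and \<open>X'\<close>, its image along
  \<open>Y\<close> and \<open>Y'\<close>. All four are traces, so a set is a trace exactly when both
  of its pieces are.\<close>

lemma exchange_Un:
  assumes T: "exchange T X Y" "exchange T X' Y'"
    and XY: "X \<in> traces" "X' \<in> traces" "Y \<in> traces" "Y' \<in> traces" "X \<inter> X' = {}" "Y \<inter> Y' = {}"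
  shows "exchange T (X \<union> X') (Y \<union> Y')"
  unfolding exchange_def
proof (intro conjI allI impI)
  have im: "T ` X = Y" "T ` X' = Y'" using T by (auto simp: exchange_def bij_betw_def)
  show "bij_betw T (X \<union> X') (Y \<union> Y')"
    using T XY(6) by (auto simp: exchange_def intro: bij_betw_combine)
  fix A assume A: "A \<subseteq> X \<union> X'"
  define B B' where "B = A \<inter> X" and "B' = A \<inter> X'"
  have A_eq: "A = B \<union> B'" "B \<inter> B' = {}" "B \<subseteq> X" "B' \<subseteq> X'" using A XY(5) by (auto simp: B_def B'_def)
  have TA: "T ` A = T ` B \<union> T ` B'" using A_eq by auto
  have sub: "T ` B \<subseteq> Y" "T ` B' \<subseteq> Y'" using A_eq(3,4) im by auto
  have sep: "Q = (Q \<union> R) \<inter> S" if "Q \<subseteq> S" "R \<subseteq> S'" "S \<inter> S' = {}" for Q R S S' :: "real set"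
    using that by blast
  \<comment> \<open>The pieces of the image are recovered by intersecting with the targets, which is
    possible because the targets are disjoint.\<close>
  have TB: "T ` B = T ` A \<inter> Y" "T ` B' = T ` A \<inter> Y'"
    unfolding TA by (rule sep[OF sub XY(6)], subst Un_commute, rule sep[OF sub(2,1)]) (use XY(6) in auto)
  have "A \<in> traces \<longleftrightarrow> B \<in> traces \<and> B' \<in> traces"
    using A_eq(1) XY(1,2) B_def B'_def by (metis traces_Int traces_Un)
  moreover have "T ` A \<in> traces \<longleftrightarrow> T ` B \<in> traces \<and> T ` B' \<in> traces"
    using TA TB XY(3,4) by (metis traces_Int traces_Un)
  moreover have "T ` B \<in> traces \<longleftrightarrow> B \<in> traces" "T ` B' \<in> traces \<longleftrightarrow> B' \<in> traces"
    using T A_eq(3,4) by (auto simp: exchange_def)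
  ultimately show iff: "T ` A \<in> traces \<longleftrightarrow> A \<in> traces" by blast
  assume "A \<in> traces"
  then have tr: "B \<in> traces" "B' \<in> traces" "T ` B \<in> traces" "T ` B' \<in> traces"
    using \<open>A \<in> traces \<longleftrightarrow> B \<in> traces \<and> B' \<in> traces\<close> \<open>T ` B \<in> traces \<longleftrightarrow> B \<in> traces\<close>
      \<open>T ` B' \<in> traces \<longleftrightarrow> B' \<in> traces\<close> by blast+
  have disj: "T ` B \<inter> T ` B' = {}" using TB XY(6) by auto
  have "emeasure lborel (T ` A) = emeasure lborel (T ` B) + emeasure lborel (T ` B')"
    unfolding TA using tr disj by (intro plus_emeasure[symmetric]) (auto intro: trace_borel)
  also have "\<dots> = emeasure lborel B + emeasure lborel B'"
    using T A_eq(3,4) tr by (simp add: exchange_def)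
  also have "\<dots> = emeasure lborel A"
    unfolding A_eq(1) using tr A_eq(2) by (intro plus_emeasure) (auto intro: trace_borel)
  finally show "emeasure lborel (T ` A) = emeasure lborel A" .
qed

lemma exchange_cong:
  assumes "exchange T X Y" "\<And>t. t \<in> X \<Longrightarrow> S t = T t"
  shows "exchange S X Y"
proof -
  have "S ` A = T ` A" if "A \<subseteq> X" for A using assms(2) that by (auto intro!: image_cong)
  then show ?thesis
    using assms unfolding exchange_def by (metis bij_betw_cong)
qed

lemma exchange_UN:
  assumes "finite P"
    and "\<And>p. p \<in> P \<Longrightarrow> X p \<in> traces \<and> Y p \<in> traces \<and> (\<exists>T. exchange T (X p) (Y p))"
    and "disjoint_family_on X P" "disjoint_family_on Y P"
  shows "\<exists>T. exchange T (\<Union>p\<in>P. X p) (\<Union>p\<in>P. Y p) \<and> (\<forall>p\<in>P. T ` X p = Y p)"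
  using assms
proof (induction P rule: finite_induct)
  case empty
  have "exchange id {} {}" by (simp add: exchange_def)
  then show ?case by auto
next
  case (insert q P)
  have "\<exists>T. exchange T (\<Union>p\<in>P. X p) (\<Union>p\<in>P. Y p) \<and> (\<forall>p\<in>P. T ` X p = Y p)"
    using insert.prems insert.hyps by (intro insert.IH) (simp_all add: disjoint_family_on_insert)
  then obtain T where T: "exchange T (\<Union>p\<in>P. X p) (\<Union>p\<in>P. Y p)" "\<And>p. p \<in> P \<Longrightarrow> T ` X p = Y p"
    by blast
  obtain S where S: "exchange S (X q) (Y q)" using insert.prems(1) by blast
  have d: "X q \<inter> (\<Union>p\<in>P. X p) = {}" "Y q \<inter> (\<Union>p\<in>P. Y p) = {}"
    using insert.prems(2,3) insert.hyps by (simp_all add: disjoint_family_on_insert)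
  define R where "R t = (if t \<in> X q then S t else T t)" for t
  have "exchange R (X q) (Y q)" using S by (rule exchange_cong) (simp add: R_def)
  moreover have RT: "R t = T t" if "t \<in> (\<Union>p\<in>P. X p)" for t using that d(1) by (auto simp: R_def)
  then have "exchange R (\<Union>p\<in>P. X p) (\<Union>p\<in>P. Y p)" using T(1) by (rule exchange_cong[rotated])
  ultimately have "exchange R (X q \<union> (\<Union>p\<in>P. X p)) (Y q \<union> (\<Union>p\<in>P. Y p))"
    using insert.prems(1) insert.hyps d by (intro exchange_Un traces_UN) auto
  moreover have "R ` X p = Y p" if "p \<in> P" for p
    using T(2)[OF that] RT that by (metis (no_types, lifting) UN_I image_cong)
  moreover have "R ` X q = Y q"
    using \<open>exchange R (X q) (Y q)\<close> by (simp add: exchange_def bij_betw_def)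
  ultimately show ?case by (intro exI[where x = R]) simp
qed

text \<open>The shift \<open>c\<close> may be negative, so it is treated as an element of the group
  \<open>V + \<int>\<close>. The bounds \<open>a\<close> and \<open>b\<close> keep the shifted
  endpoints in the unit interval, which returns them to \<open>V\<close>.\<close>

lemma shift_traces:
  assumes "A \<in> traces" "A \<subseteq> {a..<b}" "a + c \<in> V" "b + c \<in> V" "a \<in> V" "b \<in> V"
  shows "(+) c ` A \<in> traces"
proof (rule traces_eq_UN_Ico[OF assms(1)])
  fix S n assume S: "finite S" "A = (\<Union>z\<in>S. {lo z n..<hi z n})"
  have G: "c \<in> V + \<int>" using group_minus[of "a + c" a] assms by (simp add: V_iff)
  have "{c + lo z n..<c + hi z n} \<in> traces" if "z \<in> S" for z
  proof (rule Ico_in_traces)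
    have "{lo z n..<hi z n} \<subseteq> {a..<b}" using assms(2) S(2) that by blast
    then have "a \<le> lo z n" "hi z n \<le> b" using lo_less_hi[of z n] by auto
    then have "0 \<le> c + lo z n" "c + lo z n \<le> 1" "0 \<le> c + hi z n" "c + hi z n \<le> 1"
      using lo_less_hi[of z n] V_ge_0[OF assms(3)] V_le_1[OF assms(4)] by linarith+
    then show "c + lo z n \<in> V" "c + hi z n \<in> V"
      using G lo_in_V[of z n] hi_in_V[of z n] by (auto simp: V_iff intro: group_add)
  qed
  moreover have "(+) c ` A = (\<Union>z\<in>S. {c + lo z n..<c + hi z n})"
    by (simp add: S(2) image_UN add.commute)
  ultimately show ?thesis using S(1) by (simp add: traces_UN)
qed

lemma exchange_shift:
  assumes "a \<in> V" "b \<in> V" "a + c \<in> V" "b + c \<in> V"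
  shows "exchange ((+) c) {a..<b} {a + c..<b + c}"
  unfolding exchange_def
proof (intro conjI allI impI)
  show "bij_betw ((+) c) {a..<b} {a + c..<b + c}"
    by (simp add: bij_betw_def add.commute)
  fix A assume A: "A \<subseteq> {a..<b}"
  show "(+) c ` A \<in> traces \<longleftrightarrow> A \<in> traces"
  proof
    assume "(+) c ` A \<in> traces"
    moreover have "(+) c ` A \<subseteq> {a + c..<b + c}" using A by auto
    \<comment> \<open>The converse direction is the same lemma for the opposite shift.\<close>
    ultimately have "(+) (- c) ` (+) c ` A \<in> traces"
      by (rule shift_traces) (use assms in auto)
    then show "A \<in> traces" by (simp add: image_comp o_def)
  qed (use A assms shift_traces in blast)
  show "emeasure lborel ((+) c ` A) = emeasure lborel A" if "A \<in> traces"
    using that by (intro emeasure_shift trace_borel)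
qed

text \<open>The intervals composing \<open>X\<close> are packed one after another from 0, each by a
  translation. The packed length so far lies in \<open>V\<close>, being the measure of a
  trace.\<close>

lemma exchange_initial:
  assumes "X \<in> traces"
  shows "\<exists>T. exchange T X {0..<measure lborel X}"
proof (rule traces_eq_UN_Ico[OF assms])
  fix S n
  assume "finite S" and X: "X = (\<Union>z\<in>S. {lo z n..<hi z n})"
    and "disjoint_family_on (\<lambda>z. {lo z n..<hi z n}) S"
  from this(1,3) have "\<exists>T. exchange T (\<Union>z\<in>S. {lo z n..<hi z n}) {0..<measure lborel (\<Union>z\<in>S. {lo z n..<hi z n})}"
  proof (induction S rule: finite_induct)
    case empty
    have "exchange id {} {}" by (simp add: exchange_def)
    then show ?case by auto
  next
    case (insert z S)
    let ?I = "{lo z n..<hi z n}" and ?X = "\<Union>z\<in>S. {lo z n..<hi z n}"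
    define s where "s = measure lborel ?X"
    define s' where "s' = measure lborel (?I \<union> ?X)"
    have tr: "?I \<in> traces" "?X \<in> traces"
      using insert.hyps by (auto intro!: Ico_in_traces lo_in_V hi_in_V traces_UN)
    have d: "?I \<inter> ?X = {}" "disjoint_family_on (\<lambda>z. {lo z n..<hi z n}) S"
      using insert.prems insert.hyps by (simp_all add: disjoint_family_on_insert)
    have s': "s' = s + (hi z n - lo z n)"
      using measure_UN_interval[OF _ insert.prems] measure_UN_interval[OF _ d(2)] insert.hyps
      by (simp add: s_def s'_def)
    have sV: "s \<in> V" "s' \<in> V"
      unfolding s_def s'_def using tr by (auto intro!: measure_trace_in_V traces_Un)
    obtain T where T: "exchange T ?X {0..<s}" using insert.IH d(2) by (auto simp: s_def)
    have "exchange ((+) (s - lo z n)) ?I {lo z n + (s - lo z n)..<hi z n + (s - lo z n)}"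
      using sV s' by (intro exchange_shift lo_in_V hi_in_V) (simp_all add: algebra_simps)
    then have shift: "exchange ((+) (s - lo z n)) ?I {s..<s'}" by (simp add: s' algebra_simps)
    define R where "R t = (if t \<in> ?I then s - lo z n + t else T t)" for t
    have "exchange R ?I {s..<s'}" using shift by (rule exchange_cong) (simp add: R_def)
    moreover have "exchange R ?X {0..<s}"
      using T
    proof (rule exchange_cong)
      fix t assume "t \<in> ?X"
      then have "t \<notin> ?I" using d(1) by blast
      then show "R t = T t" unfolding R_def by (rule if_not_P)
    qed
    ultimately have "exchange R (?I \<union> ?X) ({s..<s'} \<union> {0..<s})"
      using tr d(1) sV by (intro exchange_Un) (auto intro: Ico_in_traces)
    moreover have "{s..<s'} \<union> {0..<s} = {0..<s'}"
      using V_ge_0[OF sV(1)] s' lo_less_hi[of z n] by auto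
    ultimately show ?case by (auto simp: s'_def)
  qed
  then show ?thesis by (simp only: X)
qed

text \<open>Both sets are packed onto the same initial interval, and one packing is followed by the
  inverse of the other.\<close>

lemma exchange_exists:
  assumes "X \<in> traces" "Y \<in> traces" "measure lborel X = measure lborel Y"
  shows "\<exists>T. exchange T X Y"
proof -
  obtain T where "exchange T X {0..<measure lborel X}" using exchange_initial[OF assms(1)] by blast
  moreover obtain S where "exchange S Y {0..<measure lborel X}"
    using exchange_initial[OF assms(2)] assms(3) by auto
  ultimately show ?thesis using exchange_trans exchange_sym by blast
qed



section \<open>Lifting exchanges to homeomorphisms of the Cantor space\<close>

lemma exchange_vimage:
  assumes "exchange T {0..<1} {0..<1}" "A \<in> traces"
  shows "{t \<in> {0..<1}. T t \<in> A} \<in> traces"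
    and "emeasure lborel {t \<in> {0..<1}. T t \<in> A} = emeasure lborel A"
proof -
  let ?B = "{t \<in> {0..<1}. T t \<in> A}"
  have "T ` {0..<1} = {0..<1}" using assms(1) by (simp add: exchange_def bij_betw_def)
  then have "A \<subseteq> T ` {0..<1}" using trace_subset[OF assms(2)] by (simp only:)
  then have "T ` ?B = A" by blast
  moreover have "?B \<subseteq> {0..<1}" by auto
  ultimately show "?B \<in> traces" "emeasure lborel ?B = emeasure lborel A"
    using exchange_traces[OF assms(1)] exchange_emeasure[OF assms(1)] assms(2) by metis+
qed

text \<open>The points that \<open>T\<close> sends to codes with bit \<open>n\<close> set form a
  trace, hence the trace of a clopen set \<open>E n\<close>. Membership in \<open>E n\<close> is
  taken as coordinate \<open>n\<close> of the lifted map, and clopenness of these sets gives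
  continuity.\<close>

lemma exchange_lift:
  assumes "exchange T {0..<1} {0..<1}"
  obtains \<phi> where "continuous_on UNIV \<phi>" "\<And>t. t \<in> {0..<1} \<Longrightarrow> \<phi> (code t) = code (T t)"
proof -
  have "bij_betw T {0..<1} {0..<1}" using assms by (simp only: exchange_def)
  note bij = bij_betw_apply[OF this]
  have "\<exists>E. clopen E \<and> pre E = {t \<in> {0..<1}. T t \<in> pre {w. w n}}" for n
    using exchange_vimage(1)[OF assms pre_in_traces[OF clopen_coordinate[of n]]]
    by (auto simp: traces_def)
  then obtain E where E: "\<And>n. clopen (E n)" "\<And>n. pre (E n) = {t \<in> {0..<1}. T t \<in> pre {w. w n}}"
    by metis
  define \<phi> where "\<phi> z n \<longleftrightarrow> z \<in> E n" for z n
  have "continuous_on UNIV \<phi>"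
    by (rule continuous_on_clopen_vimage) (simp add: \<phi>_def E(1))
  moreover have "\<phi> (code t) = code (T t)" if t: "t \<in> {0..<1}" for t
  proof
    fix n
    have "\<phi> (code t) n \<longleftrightarrow> t \<in> pre (E n)" using t by (simp add: \<phi>_def pre_def)
    also have "\<dots> \<longleftrightarrow> code (T t) n" using t bij[OF t] by (simp add: E(2)) (simp add: pre_def)
    finally show "\<phi> (code t) n = code (T t) n" .
  qed
  ultimately show ?thesis by (rule that)
qed

text \<open>The set where a coordinate of \<open>\<phi>\<close> disagrees with the identity is open
  and misses the dense set of coded points.\<close>

lemma continuous_id_on_code:
  assumes "continuous_on UNIV \<phi>" "\<And>t. t \<in> {0..<1} \<Longrightarrow> \<phi> (code t) = code t"
  shows "\<phi> z = z"
proof -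
  have "{z. \<phi> z n \<noteq> z n} = {}" for n
  proof (rule pre_eq_empty)
    show "open {z. \<phi> z n \<noteq> z n}"
      by (intro open_Collect_neq continuous_on_product_coordinates continuous_on_product_then_coordinatewise[OF assms(1)])
    show "pre {z. \<phi> z n \<noteq> z n} = {}" using assms(2) by (auto simp: pre_def)
  qed
  then show ?thesis by auto
qed

text \<open>The map and its inverse are lifted separately. Their composites fix every coded point
  and are therefore the identity. Preservation of the measure is checked on clopen sets
  only.\<close>

lemma exchange_homeomorphism:
  assumes T: "exchange T {0..<1} {0..<1}"
  obtains \<phi> \<psi> where "homeomorphism UNIV UNIV \<phi> \<psi>" "distr split_measure split_measure \<phi> = split_measure"
    "\<And>U. pre (\<phi> -` U) = {t \<in> {0..<1}. T t \<in> pre U}"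
proof -
  let ?T' = "inv_into {0..<1} T"
  have bij: "bij_betw T {0..<1} {0..<1}" using T by (simp add: exchange_def)
  obtain \<phi> where \<phi>: "continuous_on UNIV \<phi>" "\<And>t. t \<in> {0..<1} \<Longrightarrow> \<phi> (code t) = code (T t)"
    by (rule exchange_lift[OF T]) blast
  obtain \<psi> where \<psi>: "continuous_on UNIV \<psi>" "\<And>t. t \<in> {0..<1} \<Longrightarrow> \<psi> (code t) = code (?T' t)"
    by (rule exchange_lift[OF exchange_sym[OF T]]) blast
  have T_mem: "T t \<in> {0..<1}" "?T' t \<in> {0..<1}" if "t \<in> {0..<1}" for t
    using that by (rule bij_betw_apply[OF bij], rule bij_betw_apply[OF bij_betw_inv_into[OF bij]])
  have T_inv: "T (?T' t) = t" "?T' (T t) = t" if "t \<in> {0..<1}" for t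
    using that bij by (auto simp: bij_betw_inv_into_left bij_betw_inv_into_right)
  have cont: "continuous_on UNIV (\<psi> \<circ> \<phi>)" "continuous_on UNIV (\<phi> \<circ> \<psi>)"
    using continuous_on_compose[OF \<phi>(1) continuous_on_subset[OF \<psi>(1) subset_UNIV]]
      continuous_on_compose[OF \<psi>(1) continuous_on_subset[OF \<phi>(1) subset_UNIV]] .
  have fixed: "(\<psi> \<circ> \<phi>) (code t) = code t" "(\<phi> \<circ> \<psi>) (code t) = code t" if "t \<in> {0..<1}" for t
    using T_mem[OF that] T_inv[OF that] \<phi>(2) \<psi>(2) that by (simp_all only: o_apply)
  have inv: "(\<psi> \<circ> \<phi>) z = z" "(\<phi> \<circ> \<psi>) z = z" for z
    using continuous_id_on_code[OF cont(1) fixed(1)] continuous_id_on_code[OF cont(2) fixed(2)] by blast+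
  show ?thesis
  proof
    show "homeomorphism UNIV UNIV \<phi> \<psi>"
      using \<phi>(1) \<psi>(1) inv by (intro homeomorphismI) simp_all
    show pre_eq: "pre (\<phi> -` U) = {t \<in> {0..<1}. T t \<in> pre U}" for U
    proof (rule set_eqI)
      fix t show "t \<in> pre (\<phi> -` U) \<longleftrightarrow> t \<in> {t \<in> {0..<1}. T t \<in> pre U}"
      proof (cases "t \<in> {0..<1}")
        case True
        then show ?thesis
          using \<phi>(2)[OF True] T_mem(1)[OF True] unfolding pre_def mem_Collect_eq vimage_eq by simp
      next
        case False
        then show ?thesis unfolding pre_def mem_Collect_eq by blast
      qed
    qed
    have meas: "\<phi> \<in> split_measure \<rightarrow>\<^sub>M split_measure"
      using borel_measurable_continuous_onI[OF \<phi>(1)] by (simp cong: measurable_cong_sets)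
    show "distr split_measure split_measure \<phi> = split_measure"
    proof (rule borel_measure_eqI_clopen)
      fix U assume U: "clopen U"
      then have "emeasure (distr split_measure split_measure \<phi>) U = emeasure split_measure (\<phi> -` U)"
        using meas by (simp add: emeasure_distr clopen_in_borel)
      also have "\<dots> = emeasure lborel {t \<in> {0..<1}. T t \<in> pre U}"
        by (simp only: emeasure_split_measure clopen_in_borel[OF clopen_vimage[OF \<phi>(1) U]] pre_eq)
      also have "\<dots> = emeasure split_measure U"
        by (simp only: exchange_vimage(2)[OF T pre_in_traces[OF U]] emeasure_split_measure clopen_in_borel[OF U])
      finally show "emeasure (distr split_measure split_measure \<phi>) U = emeasure split_measure U" .
    qed (use meas in \<open>simp_all add: emeasure_distr emeasure_split_measure\<close>)
  qed
qed

text \<open>Cells matched by \<open>f\<close> have traces of equal length. The exchanges between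
  these traces are glued to one exchange of the whole unit interval, which is then lifted.\<close>

lemma ultrahomogeneous_split_measure: "ultrahomogeneous split_measure"
  unfolding ultrahomogeneous_def
proof (intro allI impI)
  fix P R f
  assume *: "clopen_partition P \<and> clopen_partition R \<and> bij_betw f P R \<and>
      (\<forall>x\<in>P. measure split_measure x = measure split_measure (f x))"
  then have P: "finite P" "partition_on UNIV P" "\<And>x. x \<in> P \<Longrightarrow> clopen x"
    and R: "partition_on UNIV R" "\<And>x. x \<in> R \<Longrightarrow> clopen x"
    and f: "bij_betw f P R" by (auto simp: clopen_partition_def)
  have fR: "f x \<in> R" if "x \<in> P" for x using f that by (auto simp: bij_betw_def)
  have "\<exists>T. exchange T (pre x) (pre (f x))" if "x \<in> P" for x
    using * that P(3)[OF that] R(2)[OF fR[OF that]]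
    by (intro exchange_exists pre_in_traces) (auto simp: measure_split_measure clopen_in_borel)
  moreover have "disjoint_family_on pre P"
    using P(2) by (auto simp: disjoint_family_on_def pre_Int[symmetric] partition_on_def disjoint_def)
  moreover have "disjoint_family_on (\<lambda>x. pre (f x)) P"
    unfolding disjoint_family_on_def pre_Int[symmetric]
  proof (intro ballI impI)
    fix x y assume "x \<in> P" "y \<in> P" "x \<noteq> y"
    then have "f x \<noteq> f y" using f by (auto simp: bij_betw_def inj_on_def)
    then show "pre (f x \<inter> f y) = {}"
      using R(1) fR \<open>x \<in> P\<close> \<open>y \<in> P\<close> by (simp add: partition_on_def disjoint_def)
  qed
  ultimately have "\<exists>T. exchange T (\<Union>x\<in>P. pre x) (\<Union>x\<in>P. pre (f x)) \<and> (\<forall>x\<in>P. T ` pre x = pre (f x))"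
    using P R(2) fR by (intro exchange_UN) (auto intro: pre_in_traces)
  moreover have "(\<Union>x\<in>P. pre x) = {0..<1}"
    using P(2) by (simp add: pre_UN[symmetric] partition_on_def)
  moreover have "(\<Union>x\<in>P. pre (f x)) = {0..<1}"
  proof -
    have "(\<Union>x\<in>P. f x) = UNIV" using R(1) f by (auto simp: partition_on_def bij_betw_def)
    then show ?thesis by (simp add: pre_UN[symmetric])
  qed
  ultimately obtain T where T: "exchange T {0..<1} {0..<1}" "\<And>x. x \<in> P \<Longrightarrow> T ` pre x = pre (f x)"
    by auto
  obtain \<phi> \<psi> where h: "homeomorphism UNIV UNIV \<phi> \<psi>" "distr split_measure split_measure \<phi> = split_measure"
    and pre_eq: "\<And>U. pre (\<phi> -` U) = {t \<in> {0..<1}. T t \<in> pre U}"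
    by (rule exchange_homeomorphism[OF T(1)]) blast
  have "\<phi> ` x = f x" if x: "x \<in> P" for x
  proof -
    have "inj_on T {0..<1}" using T(1) by (simp add: exchange_def bij_betw_def)
    \<comment> \<open>Injectivity of \<open>T\<close> ensures that only points of
      \<open>pre x\<close> reach \<open>pre (f x)\<close>. The preimage of \<open>f x\<close> then
      has the same trace as \<open>x\<close>, and both are clopen.\<close>
    then have "{t \<in> {0..<1}. T t \<in> pre (f x)} = pre x"
      using T(2)[OF x] pre_subset[of x] by (auto simp: T(2)[OF x, symmetric] dest: inj_onD)
    then have "pre (\<phi> -` f x) = pre x" by (simp add: pre_eq)
    moreover have "clopen (\<phi> -` f x)"
      using h(1) R(2)[OF fR[OF x]] by (intro clopen_vimage) (auto simp: homeomorphism_def)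
    ultimately have "\<phi> -` f x = x" using P(3)[OF x] by (intro pre_inject)
    moreover have "surj \<phi>" using h(1) by (simp add: homeomorphism_def)
    ultimately show ?thesis by (metis surj_image_vimage_eq)
  qed
  then show "\<exists>\<phi> \<psi>. homeomorphism UNIV UNIV \<phi> \<psi> \<and>
      distr split_measure split_measure \<phi> = split_measure \<and> (\<forall>x\<in>P. \<phi> ` x = f x)"
    using h by blast
qed

end

subsection \<open>The category of a group-like set\<close>

lemma countable_F_ob:
  assumes "countable V"
  shows "countable (F_ob V)"
proof -
  have "F_ob V \<subseteq> (SIGMA P : {P. finite P \<and> P \<subseteq> {U. clopen U}}. P \<rightarrow>\<^sub>E V)"
    by (auto simp: F_ob_def clopen_partition_def)
  moreover have "countable \<dots>"
    using assms countable_clopen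
    by (intro countable_SIGMA countable_Collect_finite_subset countable_PiE) auto
  ultimately show ?thesis by (rule countable_subset)
qed

lemma countable_cat_F_cat:
  assumes "countable V"
  shows "countable_cat (F_cat V)"
proof -
  have "{(A, B, f). A \<in> F_ob V \<and> B \<in> F_ob V \<and> f \<in> F_hom A B} \<subseteq>
      (SIGMA A : F_ob V. SIGMA B : F_ob V. fst A \<rightarrow>\<^sub>E fst B)"
    by (auto simp: F_hom_def)
  moreover have "countable \<dots>"
    by (intro countable_SIGMA countable_F_ob[OF assms] countable_PiE countable_finite)
      (auto simp: F_ob_def clopen_partition_def)
  ultimately show ?thesis
    using countable_F_ob[OF assms] by (auto simp: countable_cat_def F_cat_def intro: countable_subset)
qed

section \<open>Transport matrices over a group of reals\<close>

lemma split_weight: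
  assumes G: "additive_subgroup_real G"
    and "finite B" "\<And>y. y \<in> B \<Longrightarrow> b y \<in> G \<and> 0 \<le> b y" "t \<in> G" "0 \<le> t" "t \<le> sum b B"
  shows "\<exists>c. (\<forall>y\<in>B. c y \<in> G \<and> 0 \<le> c y \<and> c y \<le> b y) \<and> sum c B = t"
  using assms(2-)
proof (induction B arbitrary: t rule: finite_induct)
  case (insert x B)
  \<comment> \<open>The greedy choice: \<open>x\<close> takes as much of \<open>t\<close> as its
    capacity allows. A minimum of two group elements is one of them, so no division leaves the
    group.\<close>
  define u where "u = min (b x) t"
  have bx: "b x \<in> G" "0 \<le> b x" using insert.prems(1) by auto
  have u: "u \<in> G" "0 \<le> u" "u \<le> b x" "u \<le> t"
    using bx insert.prems by (auto simp: u_def min_def)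
  have "t + - u \<in> G" using G u(1) insert.prems(2) by (simp only: additive_subgroup_real_def)
  moreover have "0 \<le> sum b B" using insert.prems(1) by (intro sum_nonneg) auto
  then have "t + - u \<le> sum b B" using insert.prems(4) insert.hyps by (auto simp: u_def min_def)
  ultimately have "\<exists>c. (\<forall>y\<in>B. c y \<in> G \<and> 0 \<le> c y \<and> c y \<le> b y) \<and> sum c B = t + - u"
    using insert.prems(1) u(4) by (intro insert.IH) auto
  then obtain c where c: "\<forall>y\<in>B. c y \<in> G \<and> 0 \<le> c y \<and> c y \<le> b y" "sum c B = t + - u" by blast
  have "sum (c(x := u)) B = sum c B" using insert.hyps by (intro sum.cong) auto
  then show ?case
    using c u insert.hyps by (intro exI[where x = "c(x := u)"]) auto
qed simp

text \<open>Rows are filled one at a time. The row of \<open>x\<close> is a part of the column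
  totals with sum \<open>a x\<close>, and the remaining totals \<open>b y - r y\<close> are left to
  the other rows; hence the induction generalises over \<open>b\<close>.\<close>

lemma transport_matrix:
  assumes G: "additive_subgroup_real G"
    and "finite A" "finite B" "\<And>x. x \<in> A \<Longrightarrow> a x \<in> G \<and> 0 \<le> a x" "\<And>y. y \<in> B \<Longrightarrow> b y \<in> G \<and> 0 \<le> b y"
    and "sum a A = sum b B"
  shows "\<exists>c. (\<forall>x\<in>A. \<forall>y\<in>B. c x y \<in> G \<and> 0 \<le> c x y) \<and>
    (\<forall>x\<in>A. (\<Sum>y\<in>B. c x y) = a x) \<and> (\<forall>y\<in>B. (\<Sum>x\<in>A. c x y) = b y)"
  using assms(2-)
proof (induction A arbitrary: b rule: finite_induct)
  case empty
  then have "\<forall>y\<in>B. b y = 0" by (simp add: sum_nonneg_eq_0_iff[symmetric])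
  then show ?case by auto
next
  case (insert x A)
  have "0 \<le> sum a A" using insert.prems(2) by (intro sum_nonneg) auto
  then have "a x \<le> sum b B" using insert.prems(4) insert.hyps by simp
  then obtain r where r: "\<And>y. y \<in> B \<Longrightarrow> r y \<in> G \<and> 0 \<le> r y \<and> r y \<le> b y" "sum r B = a x"
    using split_weight[OF G insert.prems(1), of b "a x"] insert.prems(2,3) by auto
  have "b y + - r y \<in> G" if "y \<in> B" for y
    using G r(1)[OF that] insert.prems(3)[OF that] by (simp only: additive_subgroup_real_def)
  then have "\<exists>c. (\<forall>x\<in>A. \<forall>y\<in>B. c x y \<in> G \<and> 0 \<le> c x y) \<and>
    (\<forall>x\<in>A. (\<Sum>y\<in>B. c x y) = a x) \<and> (\<forall>y\<in>B. (\<Sum>x\<in>A. c x y) = b y + - r y)"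
    using insert.prems insert.hyps r by (intro insert.IH) (auto simp: sum_subtractf)
  then obtain c where c: "\<forall>x\<in>A. \<forall>y\<in>B. c x y \<in> G \<and> 0 \<le> c x y"
    "\<forall>x\<in>A. (\<Sum>y\<in>B. c x y) = a x" "\<forall>y\<in>B. (\<Sum>x\<in>A. c x y) = b y + - r y" by blast
  have "(\<Sum>z\<in>A. (c(x := r)) z y) = (\<Sum>z\<in>A. c z y)" for y
    using insert.hyps by (intro sum.cong) auto
  then show ?case
    using c r insert.hyps by (intro exI[where x = "c(x := r)"]) auto
qed

text \<open>The bijection \<open>pr\<close> lets a clopen partition \<open>D\<close> stand for an
  abstract weighted index set \<open>I\<close>. Surjectivity comes from positivity of
  \<open>\<nu>\<close>, since an empty fibre would have weight 0.\<close>

lemma F_hom_of_weights: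
  assumes bij: "bij_betw pr D I"
    and g: "\<And>p. p \<in> I \<Longrightarrow> g p \<in> Q"
    and w: "\<And>y. y \<in> Q \<Longrightarrow> \<nu> y = (\<Sum>p | p \<in> I \<and> g p = y. w p)"
    and pos: "\<And>y. y \<in> Q \<Longrightarrow> \<nu> y > 0"
  shows "restrict (g \<circ> pr) D \<in> F_hom (D, restrict (w \<circ> pr) D) (Q, \<nu>)"
proof -
  let ?s = "restrict (g \<circ> pr) D"
  have maps: "?s ` D \<subseteq> Q" using bij g by (auto simp: bij_betw_def)
  have marginal: "\<nu> y = (\<Sum>d | d \<in> D \<and> ?s d = y. restrict (w \<circ> pr) D d)" if "y \<in> Q" for y
  proof -
    have "bij_betw pr {d \<in> D. g (pr d) = y} {p \<in> I. g p = y}"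
      using bij by (auto simp: bij_betw_def inj_on_def)
    then have "\<nu> y = (\<Sum>d | d \<in> D \<and> g (pr d) = y. w (pr d))"
      using w[OF that] by (simp add: sum.reindex_bij_betw)
    also have "\<dots> = (\<Sum>d | d \<in> D \<and> ?s d = y. restrict (w \<circ> pr) D d)"
      by (intro sum.cong) auto
    finally show ?thesis .
  qed
  have "y \<in> ?s ` D" if "y \<in> Q" for y
  proof (rule ccontr)
    assume "y \<notin> ?s ` D"
    then have no: "{d. d \<in> D \<and> ?s d = y} = {}" by blast
    show False using marginal[OF that] pos[OF that] unfolding no by simp
  qed
  then have "?s ` D = Q" using maps by blast
  then show ?thesis using marginal maps unfolding F_hom_def by auto
qed

section \<open>Amalgamation and directedness\<close>

context group_like_set begin

lemma additive_subgroup_V: "additive_subgroup_real (V + \<int>)"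
  using group_like by (simp add: group_like_def)

text \<open>Objects must be partitions of the Cantor space, so a finite weighted index set is
  realised by a clopen partition with equally many cells.\<close>

lemma clopen_partition_indexed:
  assumes "finite I" "\<And>i. i \<in> I \<Longrightarrow> w i \<in> V \<and> w i \<noteq> 0" "sum w I = 1"
  obtains D pr where "clopen_partition D" "bij_betw pr D I"
proof -
  obtain e where e: "bij_betw e {..<card I} I"
    using ex_bij_betw_nat_finite[OF assms(1)] by (auto simp: atLeast0LessThan)
  have "e i \<in> I" if "i < card I" for i using e that by (auto simp: bij_betw_def)
  moreover have "(\<Sum>i<card I. w (e i)) = 1" using assms(3) e by (simp add: sum.reindex_bij_betw)
  ultimately obtain x where x: "inj_on x {..<card I}" "clopen_partition (x ` {..<card I})"
    using clopen_partition_of_weights[of "card I" "\<lambda>i. w (e i)"] assms(2) by blast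
  have "bij_betw (e \<circ> inv_into {..<card I} x) (x ` {..<card I}) I"
    using e x(1) by (intro bij_betw_trans[OF bij_betw_inv_into]) (auto simp: bij_betw_def)
  with x(2) show ?thesis by (rule that)
qed

lemma has_amalgamation_F_cat: "has_amalgamation (F_cat V)"
  unfolding has_amalgamation_def
proof (intro ballI)
  fix A B0 B1 r0 r1
  assume ob: "A \<in> Ob (F_cat V)" "B0 \<in> Ob (F_cat V)" "B1 \<in> Ob (F_cat V)"
    and hom: "r0 \<in> Hom (F_cat V) B0 A" "r1 \<in> Hom (F_cat V) B1 A"
  obtain P \<mu> Q0 \<nu>0 Q1 \<nu>1 where eqs: "A = (P, \<mu>)" "B0 = (Q0, \<nu>0)" "B1 = (Q1, \<nu>1)"
    by (metis surj_pair)
  have fin: "finite Q0" "finite Q1"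
    and V0: "\<And>y. y \<in> Q0 \<Longrightarrow> \<nu>0 y \<in> V" and V1: "\<And>z. z \<in> Q1 \<Longrightarrow> \<nu>1 z \<in> V"
    and pos: "\<And>y. y \<in> Q0 \<Longrightarrow> \<nu>0 y > 0" "\<And>z. z \<in> Q1 \<Longrightarrow> \<nu>1 z > 0"
    and total: "sum \<nu>0 Q0 = 1"
    using ob by (auto simp: eqs F_cat_def F_ob_def clopen_partition_def)
  have r: "\<And>y. y \<in> Q0 \<Longrightarrow> r0 y \<in> P" "\<And>z. z \<in> Q1 \<Longrightarrow> r1 z \<in> P"
    and \<mu>: "\<And>x. x \<in> P \<Longrightarrow> \<mu> x = (\<Sum>y | y \<in> Q0 \<and> r0 y = x. \<nu>0 y)"
      "\<And>x. x \<in> P \<Longrightarrow> \<mu> x = (\<Sum>z | z \<in> Q1 \<and> r1 z = x. \<nu>1 z)"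
    using hom by (auto simp: eqs F_cat_def F_hom_def)
  have "\<forall>x\<in>P. \<exists>c. (\<forall>y\<in>{y \<in> Q0. r0 y = x}. \<forall>z\<in>{z \<in> Q1. r1 z = x}. c y z \<in> V + \<int> \<and> 0 \<le> c y z) \<and>
    (\<forall>y\<in>{y \<in> Q0. r0 y = x}. (\<Sum>z | z \<in> Q1 \<and> r1 z = x. c y z) = \<nu>0 y) \<and>
    (\<forall>z\<in>{z \<in> Q1. r1 z = x}. (\<Sum>y | y \<in> Q0 \<and> r0 y = x. c y z) = \<nu>1 z)" (is "\<forall>x\<in>P. \<exists>c. ?C x c")
  proof
    fix x assume "x \<in> P"
    \<comment> \<open>Both fibres over \<open>x\<close> have total weight \<open>\<mu> x\<close>,
      which is the balance condition for a transport matrix.\<close>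
    then show "\<exists>c. ?C x c"
      using fin V0 V1 \<mu>(1)[of x] \<mu>(2)[of x]
      by (intro transport_matrix additive_subgroup_V) (auto simp: V_iff)
  qed
  from bchoice[OF this] obtain c where "\<forall>x\<in>P. ?C x (c x)" ..
  note C = bspec[OF this]
  have c: "c x y z \<in> V + \<int> \<and> 0 \<le> c x y z" if "x \<in> P" "y \<in> Q0" "r0 y = x" "z \<in> Q1" "r1 z = x" for x y z
    using C[OF that(1)] that(2-) by simp
  have c0: "(\<Sum>z | z \<in> Q1 \<and> r1 z = x. c x y z) = \<nu>0 y" if "x \<in> P" "y \<in> Q0" "r0 y = x" for x y
    using C[OF that(1)] that(2-) by simp
  have c1: "(\<Sum>y | y \<in> Q0 \<and> r0 y = x. c x y z) = \<nu>1 z" if "x \<in> P" "z \<in> Q1" "r1 z = x" for x z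
    using C[OF that(1)] that(2-) by simp
  define w where "w p = c (r0 (fst p)) (fst p) (snd p)" for p
  \<comment> \<open>Weights in an object must be positive, so pairs with entry 0 are discarded. The
    marginal sums do not change.\<close>
  define I where "I = {p \<in> Q0 \<times> Q1. r0 (fst p) = r1 (snd p) \<and> w p \<noteq> 0}"
  have finI: "finite I" using fin by (auto simp: I_def)
  have marginal0: "\<nu>0 y = (\<Sum>p | p \<in> I \<and> fst p = y. w p)" if y: "y \<in> Q0" for y
  proof -
    have "\<nu>0 y = (\<Sum>z | z \<in> Q1 \<and> r1 z = r0 y. w (y, z))"
      using c0[OF r(1)[OF y] y refl] by (simp add: w_def)
    also have "\<dots> = (\<Sum>p\<in>Pair y ` {z \<in> Q1. r1 z = r0 y}. w p)"
      by (subst sum.reindex) (auto simp: inj_on_def)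
    also have "\<dots> = (\<Sum>p | p \<in> I \<and> fst p = y. w p)"
      using fin y by (intro sum.mono_neutral_right) (auto simp: I_def)
    finally show ?thesis .
  qed
  have marginal1: "\<nu>1 z = (\<Sum>p | p \<in> I \<and> snd p = z. w p)" if z: "z \<in> Q1" for z
  proof -
    have "\<nu>1 z = (\<Sum>y | y \<in> Q0 \<and> r0 y = r1 z. w (y, z))"
      using c1[OF r(2)[OF z] z refl] by (simp add: w_def)
    also have "\<dots> = (\<Sum>p\<in>(\<lambda>y. (y, z)) ` {y \<in> Q0. r0 y = r1 z}. w p)"
      by (subst sum.reindex) (auto simp: inj_on_def)
    also have "\<dots> = (\<Sum>p | p \<in> I \<and> snd p = z. w p)"
      using fin z by (intro sum.mono_neutral_right) (auto simp: I_def)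
    finally show ?thesis .
  qed
  have "sum w I = (\<Sum>y\<in>Q0. \<Sum>p | p \<in> I \<and> fst p = y. w p)"
    using finI fin by (intro sum.group[symmetric]) (auto simp: I_def)
  also have "\<dots> = 1" using marginal0 total by simp
  finally have sum_w: "sum w I = 1" .
  have w0: "w p \<in> V + \<int> \<and> 0 \<le> w p" if "p \<in> I" for p
    using that c r by (auto simp: I_def w_def)
  have wV: "w p \<in> V \<and> w p > 0" if p: "p \<in> I" for p
  proof -
    \<comment> \<open>Entries are known only to be nonnegative elements of
      \<open>V + \<int>\<close>; the total 1 bounds each of them and so puts it in
      \<open>V\<close>.\<close>
    have "w p \<le> sum w I" using finI p w0 by (intro member_le_sum) auto
    moreover have "w p \<noteq> 0" using p by (simp add: I_def)
    ultimately show ?thesis using w0[OF p] sum_w by (auto simp: V_iff)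
  qed
  obtain D pr where D: "clopen_partition D" "bij_betw pr D I"
    using clopen_partition_indexed[OF finI, of w] wV sum_w by (metis less_irrefl)
  have prI: "pr d \<in> I" if "d \<in> D" for d using D(2) that by (rule bij_betw_apply)
  define \<rho> where "\<rho> = restrict (w \<circ> pr) D"
  have "sum \<rho> D = (\<Sum>d\<in>D. w (pr d))" by (simp add: \<rho>_def)
  also have "\<dots> = 1" using D(2) sum_w by (simp add: sum.reindex_bij_betw)
  finally have "(D, \<rho>) \<in> F_ob V"
    using D(1) prI wV by (auto simp: F_ob_def \<rho>_def)
  moreover have "restrict (fst \<circ> pr) D \<in> F_hom (D, \<rho>) (Q0, \<nu>0)"
    unfolding \<rho>_def using marginal0 pos by (intro F_hom_of_weights[OF D(2)]) (auto simp: I_def)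
  moreover have "restrict (snd \<circ> pr) D \<in> F_hom (D, \<rho>) (Q1, \<nu>1)"
    unfolding \<rho>_def using marginal1 pos by (intro F_hom_of_weights[OF D(2)]) (auto simp: I_def)
  \<comment> \<open>The square commutes because \<open>I\<close> contains only pairs with a common
    image in \<open>P\<close>; off \<open>D\<close> both sides are \<open>undefined\<close>.\<close>
  moreover have "compose D r0 (restrict (fst \<circ> pr) D) = compose D r1 (restrict (snd \<circ> pr) D)"
    using prI by (intro ext) (simp add: compose_def I_def)
  ultimately show "\<exists>D\<in>Ob (F_cat V). \<exists>s0\<in>Hom (F_cat V) D B0. \<exists>s1\<in>Hom (F_cat V) D B1.
      Comp (F_cat V) D B0 A r0 s0 = Comp (F_cat V) D B1 A r1 s1"
    unfolding eqs F_cat_def by (auto intro!: bexI[where x = "(D, \<rho>)"] bexI)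
qed

text \<open>The one-cell partition is a terminal object, so directedness is amalgamation over it.\<close>

lemma directed_cat_F_cat: "directed_cat (F_cat V)"
  unfolding directed_cat_def
proof (intro ballI)
  let ?T = "({UNIV}, restrict (\<lambda>_. 1) {UNIV})"
  have T: "?T \<in> Ob (F_cat V)"
    by (simp add: F_cat_def F_ob_def clopen_partition_def partition_on_def disjoint_def)
  have hom: "restrict (\<lambda>_. UNIV) (fst B) \<in> Hom (F_cat V) B ?T" if "B \<in> Ob (F_cat V)" for B
  proof -
    obtain Q \<nu> where B: "B = (Q, \<nu>)" by (metis surj_pair)
    then have Q: "Q \<noteq> {}" "sum \<nu> Q = 1" using that by (auto simp: F_cat_def F_ob_def)
    have "{y. y \<in> Q \<and> restrict (\<lambda>_. UNIV) Q y = UNIV} = Q" by auto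
    then show ?thesis using Q by (auto simp: B F_cat_def F_hom_def)
  qed
  fix A0 A1 assume "A0 \<in> Ob (F_cat V)" "A1 \<in> Ob (F_cat V)"
  then show "\<exists>B\<in>Ob (F_cat V). Hom (F_cat V) B A0 \<noteq> {} \<and> Hom (F_cat V) B A1 \<noteq> {}"
    using has_amalgamation_F_cat T hom unfolding has_amalgamation_def by blast
qed

end

theorem proposition3p3:
  fixes V :: "real set"
  assumes "group_like V"
  shows "countable_cat (F_cat V) \<and> directed_cat (F_cat V) \<and> has_amalgamation (F_cat V) \<and>
    (\<exists>\<mu>. borel_prob \<mu> \<and> full_measure \<mu> \<and> maximal_measure \<mu> \<and> ultrahomogeneous \<mu> \<and>
         clopen_values \<mu> = V)"
proof -
  interpret group_like_set V by unfold_locales (rule assms)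
  show ?thesis
    using countable_cat_F_cat[OF countable_V] directed_cat_F_cat has_amalgamation_F_cat
      borel_prob_split_measure full_measure_split_measure maximal_measure_split_measure
      ultrahomogeneous_split_measure clopen_values_split_measure by blast
qed

end
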